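(* Let $n\ge 2$ and let $\Omega\subset\mathbb{R}^n$ be an open set with finite Lebesgue measure $|\Omega|<\infty$. Let $0<\lambda_1\le\lambda_2\le\dots$ be the eigenvalues (counted with multiplicity) of the Stokes operator $A$ on $\Omega$ with Dirichlet boundary conditions. Then for every $m=1,2,\dots$ $$ \sum_{k=1}^m\lambda_k\,\ge\,\frac{n}{2+n}\left(\frac{(2\pi)^n}{\omega_n(n-1)|\Omega|}\right)^{2/n}m^{1+2/n}. $$
   Context: $\omega_n=\pi^{n/2}/\Gamma(1+n/2)$ is the volume of the unit ball in $\mathbb{R}^n$ and $|\Omega|$ is the $n$-dimensional Lebesgue measure. Let $\mathcal{V}$ be the set of smooth compactly supported divergence-free vector functions $u:\Omega\to\mathbb{R}^n$, $u\in C_0^\infty(\Omega)^n$, $\operatorname{div}u=0$. Let $H$ and $V$ be the closures of $\mathcal{V}$ in $L_2(\Omega)^n$ and $H^1(\Omega)^n$, respectively. The Stokes operator $A:V\to V'$ is defined by $(Au,v)=(\nabla u,\nabla v)$ for all $u,v\in V$, where $(\nabla u,\nabla v)=\int_\Omega\sum_{i,j=1}^n\partial_iu^j\,\partial_iv^j\,dx$. Viewed in $H$, it is an unbounded self-adjoint positive operator with compact inverse. It has a system of eigenfunctions $\{v_k\}_{k=1}^\infty\subset V$, orthonormal in $H$ and complete in $H$ and $V$, with $Av_k=\lambda_kv_k$, $0<\lambda_1\le\lambda_2\le\dots$, $\lambda_k\to\infty$. *)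

theory Defs
  imports "HOL-Analysis.Analysis"
begin

section \<open>Smooth functions\<close>

definition partial :: "'n \<Rightarrow> (real ^ 'n \<Rightarrow> 'b::real_normed_vector) \<Rightarrow> real ^ 'n \<Rightarrow> 'b"
  where "partial i f x = frechet_derivative f (at x) (axis i 1)"

primrec C_diff :: "nat \<Rightarrow> (real ^ 'n \<Rightarrow> 'b::real_normed_vector) \<Rightarrow> bool"
  where
    "C_diff 0 f \<longleftrightarrow> continuous_on UNIV f"
  | "C_diff (Suc k) f \<longleftrightarrow> (\<forall>x. f differentiable (at x)) \<and> (\<forall>i. C_diff k (partial i f))"

definition smooth :: "(real ^ 'n \<Rightarrow> 'b::real_normed_vector) \<Rightarrow> bool"
  where "smooth f \<longleftrightarrow> (\<forall>k. C_diff k f)"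

text \<open>The space \<open>C\<^sub>0\<^sup>\<infinity>(\<Omega>)\<close>; its members are identified with their extensions by zero
  to the whole space.\<close>

definition test_functions :: "(real ^ 'n) set \<Rightarrow> (real ^ 'n \<Rightarrow> 'b::real_normed_vector) set"
  where "test_functions \<Omega> =
    {f. smooth f \<and> compact (closure {x. f x \<noteq> 0}) \<and> closure {x. f x \<noteq> 0} \<subseteq> \<Omega>}"

definition divergence :: "(real ^ 'n \<Rightarrow> real ^ 'n) \<Rightarrow> real ^ 'n \<Rightarrow> real"
  where "divergence u x = (\<Sum>i\<in>UNIV. partial i (\<lambda>y. u y $ i) x)"

definition solenoidal_test :: "(real ^ 'n) set \<Rightarrow> (real ^ 'n \<Rightarrow> real ^ 'n) set"
  where "solenoidal_test \<Omega> = {u \<in> test_functions \<Omega>. \<forall>x. divergence u x = 0}"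


section \<open>The spaces \<open>L\<^sub>2\<close> and \<open>H\<^sup>1\<close>\<close>

text \<open>Elements of these spaces are represented by functions, not by classes modulo null sets;
  values outside \<open>\<Omega>\<close> play no role.\<close>

definition L2 :: "(real ^ 'n) set \<Rightarrow> (real ^ 'n \<Rightarrow> 'b::euclidean_space) set"
  where "L2 \<Omega> = {f. f \<in> borel_measurable (lebesgue_on \<Omega>) \<and>
                    integrable (lebesgue_on \<Omega>) (\<lambda>x. (norm (f x))\<^sup>2)}"

definition L2_inner ::
    "(real ^ 'n) set \<Rightarrow> (real ^ 'n \<Rightarrow> 'b::euclidean_space) \<Rightarrow> (real ^ 'n \<Rightarrow> 'b) \<Rightarrow> real"
  where "L2_inner \<Omega> f g = (\<integral>x. f x \<bullet> g x \<partial>lebesgue_on \<Omega>)"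

definition L2_norm :: "(real ^ 'n) set \<Rightarrow> (real ^ 'n \<Rightarrow> 'b::euclidean_space) \<Rightarrow> real"
  where "L2_norm \<Omega> f = sqrt (L2_inner \<Omega> f f)"

text \<open>The entry \<open>G x $ i $ j\<close> is \<open>\<partial>\<^sub>i u\<^sup>j(x)\<close>, so the inner product of the type
  \<open>real ^ 'n ^ 'n\<close> is the one summed over all \<open>i\<close>, \<open>j\<close>.\<close>

definition has_weak_gradient ::
    "(real ^ 'n) set \<Rightarrow> (real ^ 'n \<Rightarrow> real ^ 'n) \<Rightarrow> (real ^ 'n \<Rightarrow> real ^ 'n ^ 'n) \<Rightarrow> bool"
  where "has_weak_gradient \<Omega> u G \<longleftrightarrow>
    (\<forall>i j. \<forall>\<phi>\<in>test_functions \<Omega>.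
       (\<integral>x. u x $ j * partial i \<phi> x \<partial>lebesgue_on \<Omega>) =
       - (\<integral>x. G x $ i $ j * \<phi> x \<partial>lebesgue_on \<Omega>))"

definition H1 :: "(real ^ 'n) set \<Rightarrow> (real ^ 'n \<Rightarrow> real ^ 'n) set"
  where "H1 \<Omega> = {u \<in> L2 \<Omega>. \<exists>G\<in>L2 \<Omega>. has_weak_gradient \<Omega> u G}"

text \<open>The weak gradient of \<open>u \<in> H\<^sup>1(\<Omega>)\<close> is unique up to null sets, which
  justifies the choice of a representative.\<close>

definition weak_grad ::
    "(real ^ 'n) set \<Rightarrow> (real ^ 'n \<Rightarrow> real ^ 'n) \<Rightarrow> real ^ 'n \<Rightarrow> real ^ 'n ^ 'n"
  where "weak_grad \<Omega> u = (SOME G. G \<in> L2 \<Omega> \<and> has_weak_gradient \<Omega> u G)"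

definition H1_norm :: "(real ^ 'n) set \<Rightarrow> (real ^ 'n \<Rightarrow> real ^ 'n) \<Rightarrow> real"
  where "H1_norm \<Omega> u = sqrt ((L2_norm \<Omega> u)\<^sup>2 + (L2_norm \<Omega> (weak_grad \<Omega> u))\<^sup>2)"


section \<open>The Stokes operator\<close>

definition stokes_H :: "(real ^ 'n) set \<Rightarrow> (real ^ 'n \<Rightarrow> real ^ 'n) set"
  where "stokes_H \<Omega> =
    {u \<in> L2 \<Omega>. \<forall>\<epsilon>>0. \<exists>\<phi>\<in>solenoidal_test \<Omega>. L2_norm \<Omega> (\<lambda>x. u x - \<phi> x) < \<epsilon>}"

definition stokes_V :: "(real ^ 'n) set \<Rightarrow> (real ^ 'n \<Rightarrow> real ^ 'n) set"
  where "stokes_V \<Omega> =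
    {u \<in> H1 \<Omega>. \<forall>\<epsilon>>0. \<exists>\<phi>\<in>solenoidal_test \<Omega>. H1_norm \<Omega> (\<lambda>x. u x - \<phi> x) < \<epsilon>}"

text \<open>The functional \<open>A u \<in> V'\<close>; only its values on \<open>V\<close> are meaningful.\<close>

definition stokes_op ::
    "(real ^ 'n) set \<Rightarrow> (real ^ 'n \<Rightarrow> real ^ 'n) \<Rightarrow> (real ^ 'n \<Rightarrow> real ^ 'n) \<Rightarrow> real"
  where "stokes_op \<Omega> u = (\<lambda>w. L2_inner \<Omega> (weak_grad \<Omega> u) (weak_grad \<Omega> w))"

text \<open>\<open>A u = \<mu> u\<close> is an identity in \<open>V'\<close>, where \<open>H\<close> is embedded into \<open>V'\<close> by
  the \<open>L\<^sub>2\<close> inner product.\<close>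

definition stokes_eigenfunction ::
    "(real ^ 'n) set \<Rightarrow> real \<Rightarrow> (real ^ 'n \<Rightarrow> real ^ 'n) \<Rightarrow> bool"
  where "stokes_eigenfunction \<Omega> \<mu> u \<longleftrightarrow>
    u \<in> stokes_V \<Omega> \<and> (\<forall>w\<in>stokes_V \<Omega>. stokes_op \<Omega> u w = \<mu> * L2_inner \<Omega> u w)"

text \<open>A sequence \<open>\<lambda>\<^sub>1 \<le> \<lambda>\<^sub>2 \<le> \<dots>\<close> lists the eigenvalues with multiplicity if it belongs to a
  complete orthonormal system of eigenfunctions. The members with index \<open>0\<close> are unused.\<close>

definition stokes_eigensystem ::
    "(real ^ 'n) set \<Rightarrow> (nat \<Rightarrow> real) \<Rightarrow> (nat \<Rightarrow> real ^ 'n \<Rightarrow> real ^ 'n) \<Rightarrow> bool"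
  where "stokes_eigensystem \<Omega> lam v \<longleftrightarrow>
    (\<forall>k\<ge>1. stokes_eigenfunction \<Omega> (lam k) (v k)) \<and>
    (\<forall>j\<ge>1. \<forall>k\<ge>1. L2_inner \<Omega> (v j) (v k) = (if j = k then 1 else 0)) \<and>
    (\<forall>u\<in>stokes_H \<Omega>. \<forall>\<epsilon>>0. \<exists>N c. L2_norm \<Omega> (\<lambda>x. u x - (\<Sum>k=1..N. c k *\<^sub>R v k x)) < \<epsilon>) \<and>
    (\<forall>u\<in>stokes_V \<Omega>. \<forall>\<epsilon>>0. \<exists>N c. H1_norm \<Omega> (\<lambda>x. u x - (\<Sum>k=1..N. c k *\<^sub>R v k x)) < \<epsilon>) \<and>
    (\<forall>k\<ge>1. 0 < lam k) \<and>
    (\<forall>k\<ge>1. lam k \<le> lam (Suc k)) \<and>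
    filterlim lam at_top sequentially"

definition stokes_eigenvalues :: "(real ^ 'n) set \<Rightarrow> (nat \<Rightarrow> real) \<Rightarrow> bool"
  where "stokes_eigenvalues \<Omega> lam \<longleftrightarrow> (\<exists>v. stokes_eigensystem \<Omega> lam v)"

end

theory Submission
  imports Defs "HOL-Probability.Characteristic_Functions"
begin

text \<open>The proof is the Berezin--Li--Yau argument, sharpened by the divergence condition.
  Let \<open>v\<^sub>1, \<dots>, v\<^sub>m\<close> be the first eigenfunctions, extended by zero to the whole space, and let
  \<open>F(\<xi>)\<close> be the sum of \<open>\<bar>v\<^sub>k^(\<xi>)\<bar>\<^sup>2\<close> over \<open>k\<close>, for the unnormalised Fourier transform \<open>v^\<close>. By
  Plancherel's theorem \<open>F\<close> has integral \<open>(2\<pi>)\<^sup>n m\<close> and \<open>\<bar>\<xi>\<bar>\<^sup>2 F\<close> has integral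
  \<open>(2\<pi>)\<^sup>n (\<lambda>\<^sub>1 + \<dots> + \<lambda>\<^sub>m)\<close>. Moreover \<open>F(\<xi>) \<le> (n - 1) \<bar>\<Omega>\<bar>\<close> for \<open>\<xi> \<noteq> 0\<close>: since \<open>div v\<^sub>k = 0\<close>, the vector
  \<open>v\<^sub>k^(\<xi>)\<close> is orthogonal to \<open>\<xi>\<close>, so only the \<open>n - 1\<close> directions perpendicular to \<open>\<xi>\<close>
  contribute, and Bessel's inequality against the plane wave in each of them costs at most \<open>\<bar>\<Omega>\<bar>\<close>
  (lemma \<open>fourier_sum_bound\<close>). Among all functions with a given integral and a given upper bound,
  the second moment is smallest if the mass fills a ball around the origin; this is used in the
  linearised form \<open>bathtub\<close>, one inequality for every radius \<open>R\<close>, and the best radius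
  (lemma \<open>optimal_radius\<close>) gives the constant of the theorem.

  The Fourier analysis is carried out for test functions only. Plancherel's theorem for continuous functions with
  compact support follows from the Fourier transform of the Gaussian, by damping the integral of
  \<open>\<bar>f^\<bar>\<^sup>2\<close> with a Gaussian that is then widened. To pass from test functions to eigenfunctions,
  each \<open>v\<^sub>k\<close> is replaced by a nearby solenoidal test function \<open>\<phi>\<^sub>k\<close>. Bessel's inequality then
  holds with a constant close to \<open>1\<close> (lemma \<open>L2_almost_bessel\<close>), and the Dirichlet integral of
  \<open>\<phi>\<^sub>k\<close> is at most slightly larger than \<open>\<lambda>\<^sub>k\<close> (lemma \<open>stokes_V_approx\<close>). Since the inequality for a fixed
  radius depends continuously on these errors, they can be sent to zero.\<close>

section \<open>The Fourier transform of the Gaussian\<close>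

lemma has_bochner_integral_prod_lborel:
  fixes f :: "'a::euclidean_space \<Rightarrow> real \<Rightarrow> 'c::{real_normed_field,banach,second_countable_topology}"
  assumes int: "\<And>b. b \<in> Basis \<Longrightarrow> integrable lborel (f b)"
  shows "has_bochner_integral lborel (\<lambda>x. \<Prod>b\<in>Basis. f b (x \<bullet> b)) (\<Prod>b\<in>Basis. \<integral>t. f b t \<partial>lborel)"
proof -
  interpret product_sigma_finite "\<lambda>b::'a. lborel :: real measure" by standard
  have meas [measurable]: "f b \<in> borel_measurable borel" if "b \<in> Basis" for b
    using borel_measurable_integrable[OF int[OF that]] by simp
  have [measurable]: "(\<lambda>x::'a. \<Prod>b\<in>Basis. f b (x \<bullet> b)) \<in> borel_measurable borel"
    by measurable
  have *: "(\<Sum>b\<in>Basis. y b *\<^sub>R b) \<bullet> b = y b" if "b \<in> Basis" for b :: 'a and y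
    using that by (simp add: inner_sum_left inner_Basis if_distrib sum.delta cong: if_cong)
  have **: "(\<lambda>y. \<Prod>b\<in>Basis. f b ((\<Sum>b\<in>Basis. y b *\<^sub>R b) \<bullet> b)) = (\<lambda>y. \<Prod>b\<in>Basis. f b (y b))"
    using * by (intro ext prod.cong) auto
  have "integrable (\<Pi>\<^sub>M b\<in>Basis. lborel) (\<lambda>y. \<Prod>b\<in>Basis. f b (y b))"
    by (rule product_integrable_prod) (use int in auto)
  moreover have "(\<integral>y. (\<Prod>b\<in>Basis. f b (y b)) \<partial>(\<Pi>\<^sub>M b\<in>Basis. lborel)) = (\<Prod>b\<in>Basis. \<integral>t. f b t \<partial>lborel)"
    by (rule product_integral_prod) (use int in auto)
  ultimately show ?thesis
    by (simp add: has_bochner_integral_iff lborel_eq[where 'a='a] integrable_distr_eq integral_distr **)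
qed

text \<open>In one dimension this is the characteristic function of the standard normal distribution,
  up to the normalising factor of its density.\<close>

lemma has_bochner_integral_gaussian_cis_real:
  fixes a :: real
  shows "has_bochner_integral lborel (\<lambda>t. exp (- t\<^sup>2 / 2) *\<^sub>R cis (t * a))
    (complex_of_real (sqrt (2 * pi) * exp (- a\<^sup>2 / 2)))"
proof -
  have eq: "exp (- t\<^sup>2 / 2) *\<^sub>R cis (t * a) =
      sqrt (2 * pi) *\<^sub>R (std_normal_density t *\<^sub>R iexp (a * t))" for t
    by (simp add: std_normal_density_def cis_conv_exp mult_ac)
  have int: "integrable lborel (\<lambda>t. std_normal_density t *\<^sub>R iexp (a * t))"
  proof (rule Bochner_Integration.integrable_bound)
    show "integrable lborel std_normal_density" by simp
    show "AE t in lborel. norm (std_normal_density t *\<^sub>R iexp (a * t)) \<le> norm (std_normal_density t)"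
      by (intro AE_I2) (simp add: norm_mult)
  qed measurable
  have "(\<integral>t. std_normal_density t *\<^sub>R iexp (a * t) \<partial>lborel) = char std_normal_distribution a"
    unfolding char_def by (subst integral_density) auto
  also have "\<dots> = exp (- a\<^sup>2 / 2)"
    by (simp add: char_std_normal_distribution)
  finally show ?thesis
    unfolding eq using int by (auto simp: has_bochner_integral_iff simp del: scaleR_scaleR) (simp add: scaleR_conv_of_real)
qed

lemma exp_norm_sq_eq_prod:
  fixes x :: "'a::euclidean_space"
  shows "exp (- (norm x)\<^sup>2 / 2) = (\<Prod>b\<in>Basis. exp (- (x \<bullet> b)\<^sup>2 / 2))"
proof -
  have "- (norm x)\<^sup>2 / 2 = (\<Sum>b\<in>Basis. - (x \<bullet> b)\<^sup>2 / 2)"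
    by (simp add: power2_norm_eq_inner euclidean_inner[of x x] sum_negf
        flip: sum_divide_distrib power2_eq_square)
  then show ?thesis
    by (simp add: exp_sum)
qed

lemma exp_norm_cis_eq_prod:
  fixes x z :: "'a::euclidean_space"
  shows "exp (- (norm x)\<^sup>2 / 2) *\<^sub>R cis (x \<bullet> z) =
    (\<Prod>b\<in>Basis. exp (- (x \<bullet> b)\<^sup>2 / 2) *\<^sub>R cis ((x \<bullet> b) * (z \<bullet> b)))"
proof -
  have "exp (- (norm x)\<^sup>2 / 2) = (\<Prod>b\<in>Basis. exp (- (x \<bullet> b)\<^sup>2 / 2))"
    by (rule exp_norm_sq_eq_prod)
  moreover have "cis (x \<bullet> z) = (\<Prod>b\<in>Basis. cis ((x \<bullet> b) * (z \<bullet> b)))"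
    by (simp add: cis_conv_exp exp_sum[symmetric] euclidean_inner[of x z] sum_distrib_left)
  ultimately show ?thesis
    by (simp add: scaleR_conv_of_real prod.distrib)
qed

lemma has_bochner_integral_gaussian_cis:
  fixes z :: "'a::euclidean_space"
  shows "has_bochner_integral lborel (\<lambda>x::'a. exp (- (norm x)\<^sup>2 / 2) *\<^sub>R cis (x \<bullet> z))
    (complex_of_real (sqrt (2 * pi) ^ DIM('a) * exp (- (norm z)\<^sup>2 / 2)))"
proof -
  have "has_bochner_integral lborel (\<lambda>x::'a. \<Prod>b\<in>Basis. exp (- (x \<bullet> b)\<^sup>2 / 2) *\<^sub>R cis ((x \<bullet> b) * (z \<bullet> b)))
     (\<Prod>b\<in>Basis. \<integral>t. exp (- t\<^sup>2 / 2) *\<^sub>R cis (t * (z \<bullet> b)) \<partial>lborel)"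
    by (rule has_bochner_integral_prod_lborel)
       (use has_bochner_integral_gaussian_cis_real in \<open>auto simp: has_bochner_integral_iff\<close>)
  moreover have "(\<Prod>b\<in>Basis. \<integral>t. exp (- t\<^sup>2 / 2) *\<^sub>R cis (t * (z \<bullet> b)) \<partial>lborel) =
      complex_of_real (sqrt (2 * pi) ^ DIM('a) * exp (- (norm z)\<^sup>2 / 2))"
  proof -
    have "(\<Prod>b\<in>Basis. \<integral>t. exp (- t\<^sup>2 / 2) *\<^sub>R cis (t * (z \<bullet> b)) \<partial>lborel) =
        (\<Prod>b\<in>(Basis::'a set). complex_of_real (sqrt (2 * pi) * exp (- (z \<bullet> b)\<^sup>2 / 2)))"
      using has_bochner_integral_gaussian_cis_real by (intro prod.cong) (auto simp: has_bochner_integral_iff)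
    also have "\<dots> = complex_of_real (sqrt (2 * pi) ^ DIM('a) * (\<Prod>b\<in>(Basis::'a set). exp (- (z \<bullet> b)\<^sup>2 / 2)))"
      unfolding of_real_prod[symmetric] prod.distrib prod_constant ..
    also have "(\<Prod>b\<in>(Basis::'a set). exp (- (z \<bullet> b)\<^sup>2 / 2)) = exp (- (norm z)\<^sup>2 / 2)"
      by (rule exp_norm_sq_eq_prod[symmetric])
    finally show ?thesis .
  qed
  ultimately show ?thesis
    unfolding exp_norm_cis_eq_prod by simp
qed

lemma integrable_gaussian:
  "integrable lborel (\<lambda>x::'a::euclidean_space. exp (- (norm x)\<^sup>2 / 2))"
  and integral_gaussian:
  "(\<integral>x. exp (- (norm (x::'a::euclidean_space))\<^sup>2 / 2) \<partial>lborel) = sqrt (2 * pi) ^ DIM('a)"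
proof -
  have *: "has_bochner_integral lborel (\<lambda>x::'a. Re (exp (- (norm x)\<^sup>2 / 2) *\<^sub>R cis (x \<bullet> 0)))
    (Re (complex_of_real (sqrt (2 * pi) ^ DIM('a) * exp (- (norm (0::'a))\<^sup>2 / 2))))"
    by (rule has_bochner_integral_bounded_linear[OF bounded_linear_Re has_bochner_integral_gaussian_cis])
  then show "integrable lborel (\<lambda>x::'a. exp (- (norm x)\<^sup>2 / 2))"
    and "(\<integral>x. exp (- (norm (x::'a))\<^sup>2 / 2) \<partial>lborel) = sqrt (2 * pi) ^ DIM('a)"
    by (auto simp: has_bochner_integral_iff simp flip: of_real_power)
qed

lemma lborel_integral_affine:
  fixes f :: "'a::euclidean_space \<Rightarrow> 'b::{banach, second_countable_topology}"
  assumes [measurable]: "f \<in> borel_measurable borel" and "c > 0"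
  shows "(\<integral>x. f x \<partial>lborel) = c ^ DIM('a) *\<^sub>R (\<integral>x. f (t + c *\<^sub>R x) \<partial>lborel)"
  using \<open>c > 0\<close> by (subst lborel_affine[of c t]) (simp_all add: integral_density integral_distr)

lemma lborel_integrable_affine:
  fixes f :: "'a::euclidean_space \<Rightarrow> 'b::{banach, second_countable_topology}"
  assumes "integrable lborel f" and "c > 0"
  shows "integrable lborel (\<lambda>x. f (t + c *\<^sub>R x))"
proof -
  have [measurable]: "f \<in> borel_measurable borel" using assms by auto
  have "integrable (density (distr lborel borel (\<lambda>x. t + c *\<^sub>R x)) (\<lambda>_. ennreal (\<bar>c\<bar> ^ DIM('a)))) f"
    using assms lborel_affine[of c t] by simp
  then have "integrable lborel (\<lambda>x. c ^ DIM('a) *\<^sub>R f (t + c *\<^sub>R x))" using \<open>c > 0\<close>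
    by (simp add: integrable_density integrable_distr_eq)
  moreover have "(\<lambda>x. (1 / c ^ DIM('a)) *\<^sub>R c ^ DIM('a) *\<^sub>R f (t + c *\<^sub>R x)) = (\<lambda>x. f (t + c *\<^sub>R x))"
    using \<open>c > 0\<close> by simp
  ultimately show ?thesis
    using integrable_scaleR_right[of "1 / c ^ DIM('a)" lborel "\<lambda>x. c ^ DIM('a) *\<^sub>R f (t + c *\<^sub>R x)"]
    by (simp only:)
qed

section \<open>Plancherel's theorem for continuous functions with compact support\<close>

lemma measurable_cis [measurable]: "cis \<in> borel_measurable borel"
  by (intro borel_measurable_continuous_onI continuous_intros)

lemma measurable_fst_borel [measurable]: "(fst :: 'a::topological_space \<times> 'b::topological_space \<Rightarrow> 'a) \<in> borel \<rightarrow>\<^sub>M borel"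
  and measurable_snd_borel [measurable]: "(snd :: 'a::topological_space \<times> 'b::topological_space \<Rightarrow> 'b) \<in> borel \<rightarrow>\<^sub>M borel"
  by (intro borel_measurable_continuous_onI continuous_intros)+

definition fourier :: "('a::euclidean_space \<Rightarrow> real) \<Rightarrow> 'a \<Rightarrow> complex"
  where "fourier f \<xi> = (\<integral>x. f x *\<^sub>R cis (- (x \<bullet> \<xi>)) \<partial>lborel)"

definition C_supp :: "('a::euclidean_space \<Rightarrow> real) \<Rightarrow> bool"
  where "C_supp f \<longleftrightarrow> continuous_on UNIV f \<and> (\<exists>K. compact K \<and> (\<forall>x. x \<notin> K \<longrightarrow> f x = 0))"

lemma C_supp_borel [measurable_dest]: "C_supp f \<Longrightarrow> f \<in> borel_measurable borel"
  by (simp add: C_supp_def borel_measurable_continuous_onI)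

lemma C_supp_integrable:
  assumes "C_supp f" shows "integrable lborel f"
proof -
  obtain K where K: "compact K" "\<And>x. x \<notin> K \<Longrightarrow> f x = 0"
    using assms by (auto simp: C_supp_def)
  have "integrable lborel (\<lambda>x. indicator K x *\<^sub>R f x)"
    using borel_integrable_compact[OF K(1), of f] assms
    by (auto simp: C_supp_def intro: continuous_on_subset)
  moreover have "(\<lambda>x. indicator K x *\<^sub>R f x) = f"
    using K(2) by (auto simp: indicator_def fun_eq_iff)
  ultimately show ?thesis by simp
qed

lemma C_supp_bounded:
  assumes "C_supp f" obtains B where "B > 0" "\<And>x. \<bar>f x\<bar> \<le> B"
proof -
  obtain K where K: "compact K" "\<And>x. x \<notin> K \<Longrightarrow> f x = 0"
    using assms by (auto simp: C_supp_def)
  have "compact (f ` K)"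
    using K(1) assms by (intro compact_continuous_image) (auto simp: C_supp_def intro: continuous_on_subset)
  then obtain B where B: "B > 0" "\<And>y. y \<in> f ` K \<Longrightarrow> norm y \<le> B"
    using compact_imp_bounded bounded_pos by metis
  then have "\<bar>f x\<bar> \<le> B" for x
    using K(2)[of x] by (cases "x \<in> K") auto
  with B show ?thesis using that by blast
qed

lemma C_supp_mult_left:
  assumes "C_supp f" "continuous_on UNIV g" shows "C_supp (\<lambda>x. f x * g x)"
  using assms by (auto simp: C_supp_def intro!: continuous_intros)

text \<open>All applications of Fubini's theorem below rest on this criterion: the integrand is a tensor
  product of integrable functions times a bounded oscillating or Gaussian factor.\<close>

lemma integrable_lborel_tensor:
  fixes f :: "'a::euclidean_space \<Rightarrow> real" and g :: "'b::euclidean_space \<Rightarrow> real"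
    and h :: "'a \<times> 'b \<Rightarrow> 'c::{banach,second_countable_topology}"
  assumes f: "integrable lborel f" and g: "integrable lborel g"
    and [measurable]: "h \<in> borel_measurable borel" and h: "\<And>p. norm (h p) \<le> B"
  shows "integrable lborel (\<lambda>p. (f (fst p) * g (snd p)) *\<^sub>R h p)"
proof (rule Bochner_Integration.integrable_bound)
  have [measurable]: "f \<in> borel_measurable borel" "g \<in> borel_measurable borel"
    using f g by auto
  have "integrable (lborel \<Otimes>\<^sub>M lborel) (\<lambda>(x, y). f x * g y)"
  proof (rule lborel_pair.Fubini_integrable)
    show "integrable lborel (\<lambda>x. \<integral>y. norm (case (x, y) of (x, y) \<Rightarrow> f x * g y) \<partial>lborel)"
      using f by (simp add: abs_mult)
    show "AE x in lborel. integrable lborel (\<lambda>y. case (x, y) of (x, y) \<Rightarrow> f x * g y)"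
      using g by simp
  qed measurable
  then show "integrable lborel (\<lambda>p. B * (f (fst p) * g (snd p)))"
    unfolding lborel_prod by (intro integrable_mult_right) (simp add: case_prod_beta')
  show "(\<lambda>p. (f (fst p) * g (snd p)) *\<^sub>R h p) \<in> borel_measurable lborel"
    by measurable
  show "AE p in lborel. norm ((f (fst p) * g (snd p)) *\<^sub>R h p) \<le> norm (B * (f (fst p) * g (snd p)))"
  proof (rule AE_I2)
    fix p
    have "norm (h p) \<le> \<bar>B\<bar>" using h[of p] by linarith
    then show "norm ((f (fst p) * g (snd p)) *\<^sub>R h p) \<le> norm (B * (f (fst p) * g (snd p)))"
      by (simp add: abs_mult mult.commute mult_left_mono mult_right_mono mult.left_commute)
  qed
qed

lemma integral_lborel_Pair:
  fixes f :: "'a::euclidean_space \<times> 'b::euclidean_space \<Rightarrow> 'c::{banach,second_countable_topology}"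
  assumes "integrable lborel f"
  shows "(\<integral>p. f p \<partial>lborel) = (\<integral>x. \<integral>y. f (x, y) \<partial>lborel \<partial>lborel)"
    and "(\<integral>p. f p \<partial>lborel) = (\<integral>y. \<integral>x. f (x, y) \<partial>lborel \<partial>lborel)"
  using lborel_pair.integral_fst'[of f] lborel_pair.integral_snd[of "\<lambda>x y. f (x,y)"] assms
  by (simp_all add: lborel_prod)

lemma integral_gaussian_cis_scaled:
  fixes z :: "'a::euclidean_space"
  assumes "s > 0"
  shows "(\<integral>\<xi>. exp (- (norm (s *\<^sub>R \<xi>))\<^sup>2 / 2) *\<^sub>R cis (\<xi> \<bullet> z) \<partial>lborel) =
    complex_of_real (sqrt (2 * pi) ^ DIM('a) / s ^ DIM('a) * exp (- (norm (z /\<^sub>R s))\<^sup>2 / 2))"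
proof -
  let ?f = "\<lambda>x::'a. exp (- (norm x)\<^sup>2 / 2) *\<^sub>R cis (x \<bullet> (z /\<^sub>R s))"
  have "complex_of_real (sqrt (2 * pi) ^ DIM('a) * exp (- (norm (z /\<^sub>R s))\<^sup>2 / 2)) = (\<integral>x. ?f x \<partial>lborel)"
    using has_bochner_integral_gaussian_cis[of "z /\<^sub>R s"] by (simp add: has_bochner_integral_iff)
  also have "\<dots> = s ^ DIM('a) *\<^sub>R (\<integral>x. ?f (0 + s *\<^sub>R x) \<partial>lborel)"
    by (rule lborel_integral_affine) (use assms in auto)
  finally show ?thesis using assms
    by (simp add: scaleR_conv_of_real field_simps)
qed

lemma integrable_gaussian_scaled:
  assumes "s > 0"
  shows "integrable lborel (\<lambda>\<xi>::'a::euclidean_space. exp (- (norm (s *\<^sub>R \<xi>))\<^sup>2 / 2))"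
  using lborel_integrable_affine[OF integrable_gaussian assms, of 0] by simp

text \<open>Writing the square as a double integral makes the dependence on \<open>\<xi>\<close> a pure phase, so that a
  Gaussian weight in \<open>\<xi>\<close> can be integrated out explicitly.\<close>

lemma fourier_norm_sq:
  fixes f :: "'a::euclidean_space \<Rightarrow> real"
  assumes f: "integrable lborel f"
  shows "complex_of_real ((norm (fourier f \<xi>))\<^sup>2) =
     (\<integral>p. (f (fst p) * f (snd p)) *\<^sub>R cis (\<xi> \<bullet> (snd p - fst p)) \<partial>lborel)"
proof -
  have [measurable]: "f \<in> borel_measurable borel" using f by auto
  have int: "integrable lborel (\<lambda>p. (f (fst p) * f (snd p)) *\<^sub>R cis (\<xi> \<bullet> (snd p - fst p)))"
    by (rule integrable_lborel_tensor[OF f f, where B=1]) (auto intro!: borel_measurable_continuous_onI continuous_intros)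
  have cnj: "cnj (fourier f \<xi>) = (\<integral>y. f y *\<^sub>R cis (y \<bullet> \<xi>) \<partial>lborel)"
    unfolding fourier_def by (subst Bochner_Integration.integral_cnj[symmetric]) (simp add: cis_cnj)
  have "complex_of_real ((norm (fourier f \<xi>))\<^sup>2) = fourier f \<xi> * cnj (fourier f \<xi>)"
    by (rule complex_norm_square)
  also have "\<dots> = (\<integral>x. \<integral>y. (f x *\<^sub>R cis (- (x \<bullet> \<xi>))) * (f y *\<^sub>R cis (y \<bullet> \<xi>)) \<partial>lborel \<partial>lborel)"
    unfolding cnj unfolding fourier_def
    by (simp only: integral_mult_left_zero integral_mult_right_zero)
  also have "\<dots> = (\<integral>x. \<integral>y. (f x * f y) *\<^sub>R cis (\<xi> \<bullet> (y - x)) \<partial>lborel \<partial>lborel)"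
    by (simp add: cis_mult inner_diff_right inner_commute algebra_simps)
  also have "\<dots> = (\<integral>p. (f (fst p) * f (snd p)) *\<^sub>R cis (\<xi> \<bullet> (snd p - fst p)) \<partial>lborel)"
    using integral_lborel_Pair(1)[OF int] by simp
  finally show ?thesis .
qed

lemma fourier_measurable [measurable]:
  fixes f :: "'a::euclidean_space \<Rightarrow> real"
  assumes [measurable]: "f \<in> borel_measurable borel"
  shows "fourier f \<in> borel_measurable borel"
  unfolding fourier_def by measurable

lemma fourier_bounded:
  fixes f :: "'a::euclidean_space \<Rightarrow> real"
  shows "norm (fourier f \<xi>) \<le> (\<integral>x. \<bar>f x\<bar> \<partial>lborel)"
  unfolding fourier_def by (rule order_trans[OF integral_norm_bound]) simp

text \<open>Integrating out \<open>\<xi>\<close> first leaves the heat kernel in \<open>y - x\<close>, of width \<open>s\<close>; the substitution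
  \<open>y = x + s w\<close> turns its singular limit \<open>s \<rightarrow> 0\<close> into the limit of a translation of \<open>f\<close>.\<close>

lemma fourier_gaussian_weighted:
  fixes f :: "'a::euclidean_space \<Rightarrow> real"
  assumes f: "C_supp f" and s: "s > 0"
  shows "(\<integral>\<xi>. exp (- (norm (s *\<^sub>R \<xi>))\<^sup>2 / 2) * (norm (fourier f \<xi>))\<^sup>2 \<partial>lborel) =
    sqrt (2 * pi) ^ DIM('a) * (\<integral>p. f (fst p) * exp (- (norm (snd p))\<^sup>2 / 2) * f (fst p + s *\<^sub>R snd p) \<partial>lborel)"
proof -
  have [measurable]: "f \<in> borel_measurable borel" using f by (rule C_supp_borel)
  note int_f = C_supp_integrable[OF f]
  let ?c = "sqrt (2 * pi) ^ DIM('a)"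
  let ?E = "\<lambda>\<xi>::'a. exp (- (norm (s *\<^sub>R \<xi>))\<^sup>2 / 2)"
  let ?g = "\<lambda>z::'a. exp (- (norm z)\<^sup>2 / 2)"
  have int_ff: "integrable lborel (\<lambda>p. (f (fst p) * f (snd p)))"
    using integrable_lborel_tensor[OF int_f int_f, of "\<lambda>_. 1::real" 1] by simp
  have int3: "integrable lborel (\<lambda>q. (?E (fst q) * (f (fst (snd q)) * f (snd (snd q)))) *\<^sub>R
      cis (fst q \<bullet> (snd (snd q) - fst (snd q))))"
    by (rule integrable_lborel_tensor[OF integrable_gaussian_scaled[OF s] int_ff, where B=1])
      (auto intro!: borel_measurable_continuous_onI continuous_intros)
  have int4: "integrable lborel (\<lambda>p. (f (fst p) * f (snd p)) * (?c / s ^ DIM('a) * ?g ((snd p - fst p) /\<^sub>R s)))"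
    using integrable_lborel_tensor[OF int_f int_f, of "\<lambda>p. ?c / s ^ DIM('a) * ?g ((snd p - fst p) /\<^sub>R s)" "?c / s ^ DIM('a)"]
    using s by (simp add: mult_left_le divide_right_mono)
  obtain B where B: "\<And>x. \<bar>f x\<bar> \<le> B" using C_supp_bounded[OF f] by metis
  have int5: "integrable lborel (\<lambda>p. (f (fst p) * ?g (snd p)) * f (fst p + s *\<^sub>R snd p))"
    using integrable_lborel_tensor[OF int_f integrable_gaussian, of "\<lambda>p. f (fst p + s *\<^sub>R snd p)" B] B
    by simp
  have "complex_of_real (\<integral>\<xi>. ?E \<xi> * (norm (fourier f \<xi>))\<^sup>2 \<partial>lborel) =
      (\<integral>\<xi>. complex_of_real (?E \<xi> * (norm (fourier f \<xi>))\<^sup>2) \<partial>lborel)"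
    by (rule integral_complex_of_real[symmetric])
  also have "\<dots> = (\<integral>\<xi>. \<integral>p. (?E \<xi> * (f (fst p) * f (snd p))) *\<^sub>R cis (\<xi> \<bullet> (snd p - fst p)) \<partial>lborel \<partial>lborel)"
    unfolding of_real_mult fourier_norm_sq[OF int_f] scaleR_scaleR[symmetric]
    by (subst integral_scaleR_right) (auto simp: scaleR_conv_of_real)
  also have "\<dots> = (\<integral>p. \<integral>\<xi>. (?E \<xi> * (f (fst p) * f (snd p))) *\<^sub>R cis (\<xi> \<bullet> (snd p - fst p)) \<partial>lborel \<partial>lborel)"
    using integral_lborel_Pair[OF int3] by simp
  also have "\<dots> = (\<integral>p. (f (fst p) * f (snd p)) *\<^sub>R (\<integral>\<xi>. ?E \<xi> *\<^sub>R cis (\<xi> \<bullet> (snd p - fst p)) \<partial>lborel) \<partial>lborel)"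
    by (subst integral_scaleR_right[symmetric]) (simp_all add: mult.commute)
  also have "\<dots> = complex_of_real (\<integral>p. (f (fst p) * f (snd p)) * (?c / s ^ DIM('a) * ?g ((snd p - fst p) /\<^sub>R s)) \<partial>lborel)"
    unfolding integral_gaussian_cis_scaled[OF s] unfolding scaleR_conv_of_real of_real_mult[symmetric]
    by (rule integral_complex_of_real)
  also have "(\<integral>p. (f (fst p) * f (snd p)) * (?c / s ^ DIM('a) * ?g ((snd p - fst p) /\<^sub>R s)) \<partial>lborel) =
     (\<integral>x. \<integral>y. (f x * f y) * (?c / s ^ DIM('a) * ?g ((y - x) /\<^sub>R s)) \<partial>lborel \<partial>lborel)"
    using integral_lborel_Pair(1)[OF int4] by simp
  also have "\<dots> = (\<integral>x. \<integral>w. ?c * (f x * ?g w * f (x + s *\<^sub>R w)) \<partial>lborel \<partial>lborel)"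
  proof (rule Bochner_Integration.integral_cong[OF refl])
    fix x
    have "(\<integral>y. (f x * f y) * (?c / s ^ DIM('a) * ?g ((y - x) /\<^sub>R s)) \<partial>lborel) =
       s ^ DIM('a) *\<^sub>R (\<integral>w. (f x * f (x + s *\<^sub>R w)) * (?c / s ^ DIM('a) * ?g ((x + s *\<^sub>R w - x) /\<^sub>R s)) \<partial>lborel)"
      by (rule lborel_integral_affine) (use s in auto)
    also have "\<dots> = (\<integral>w. ?c * (f x * ?g w * f (x + s *\<^sub>R w)) \<partial>lborel)"
      unfolding integral_scaleR_right[symmetric] using s by (intro Bochner_Integration.integral_cong) auto
    finally show "(\<integral>y. (f x * f y) * (?c / s ^ DIM('a) * ?g ((y - x) /\<^sub>R s)) \<partial>lborel) =
      (\<integral>w. ?c * (f x * ?g w * f (x + s *\<^sub>R w)) \<partial>lborel)" .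
  qed
  also have "\<dots> = ?c * (\<integral>x. \<integral>w. f x * ?g w * f (x + s *\<^sub>R w) \<partial>lborel \<partial>lborel)"
    by simp
  also have "(\<integral>x. \<integral>w. f x * ?g w * f (x + s *\<^sub>R w) \<partial>lborel \<partial>lborel) =
      (\<integral>p. f (fst p) * ?g (snd p) * f (fst p + s *\<^sub>R snd p) \<partial>lborel)"
    using integral_lborel_Pair(1)[OF int5] by simp
  finally show ?thesis
    unfolding of_real_eq_iff .
qed

text \<open>Let \<open>s \<rightarrow> 0\<close> in the previous lemma: monotone convergence on the Fourier side, dominated
  convergence on the other, where continuity of \<open>f\<close> gives the pointwise limit. Each side contributes
  a factor \<open>(2\<pi>)\<^sup>n\<^sup>/\<^sup>2\<close>.\<close>

theorem plancherel:
  fixes f :: "'a::euclidean_space \<Rightarrow> real"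
  assumes f: "C_supp f"
  shows "has_bochner_integral lborel (\<lambda>\<xi>. (norm (fourier f \<xi>))\<^sup>2) ((2 * pi) ^ DIM('a) * (\<integral>x. (f x)\<^sup>2 \<partial>lborel))"
proof -
  have [measurable]: "f \<in> borel_measurable borel" using f by (rule C_supp_borel)
  have cont: "isCont f x" for x
    using f by (auto simp: C_supp_def continuous_on_eq_continuous_at)
  note int_f = C_supp_integrable[OF f]
  let ?c = "sqrt (2 * pi) ^ DIM('a)"
  let ?g = "\<lambda>z::'a. exp (- (norm z)\<^sup>2 / 2)"
  obtain B where B: "\<And>x. \<bar>f x\<bar> \<le> B" using C_supp_bounded[OF f] by metis
  define s where "s k = inverse (real (Suc k))" for k
  have s: "s k > 0" for k by (simp add: s_def)
  have s0: "s \<longlonglongrightarrow> 0"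
    unfolding s_def by (rule LIMSEQ_inverse_real_of_nat)
  define F where "F k \<xi> = exp (- (norm (s k *\<^sub>R \<xi>))\<^sup>2 / 2) * (norm (fourier f \<xi>))\<^sup>2" for k \<xi>
  define G where "G k p = f (fst p) * ?g (snd p) * f (fst p + s k *\<^sub>R snd p)" for k p
  have FG: "integral\<^sup>L lborel (F k) = ?c * integral\<^sup>L lborel (G k)" for k
    unfolding F_def G_def by (rule fourier_gaussian_weighted[OF f s])
  have int_lim: "integrable lborel (\<lambda>p. (f (fst p) * ?g (snd p)) * f (fst p))"
    using integrable_lborel_tensor[OF int_f integrable_gaussian, of "\<lambda>p. f (fst p)" B] B by simp
  have "(\<lambda>k. integral\<^sup>L lborel (G k)) \<longlonglongrightarrow> (\<integral>p. f (fst p) * ?g (snd p) * f (fst p) \<partial>lborel)"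
  proof (rule integral_dominated_convergence)
    show "integrable lborel (\<lambda>p. B * \<bar>f (fst p) * ?g (snd p)\<bar>)"
      using integrable_lborel_tensor[OF int_f integrable_gaussian, of "\<lambda>p. 1::real" 1]
      by (intro integrable_mult_right integrable_abs) simp
    show "AE p in lborel. (\<lambda>k. G k p) \<longlonglongrightarrow> f (fst p) * ?g (snd p) * f (fst p)"
    proof (rule AE_I2)
      fix p :: "'a \<times> 'a"
      have "(\<lambda>k. fst p + s k *\<^sub>R snd p) \<longlonglongrightarrow> fst p + 0 *\<^sub>R snd p"
        by (intro tendsto_intros s0)
      then have "(\<lambda>k. f (fst p + s k *\<^sub>R snd p)) \<longlonglongrightarrow> f (fst p)"
        by (intro isCont_tendsto_compose[OF cont]) simp
      then show "(\<lambda>k. G k p) \<longlonglongrightarrow> f (fst p) * ?g (snd p) * f (fst p)"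
        unfolding G_def by (intro tendsto_intros)
    qed
    show "AE p in lborel. norm (G k p) \<le> B * \<bar>f (fst p) * ?g (snd p)\<bar>" for k
      using B by (intro AE_I2) (simp add: G_def abs_mult mult.commute[of B] mult_left_mono)
  qed (simp_all add: G_def[abs_def])
  also have "(\<integral>p. f (fst p) * ?g (snd p) * f (fst p) \<partial>lborel) =
      (\<integral>x. \<integral>w. f x * ?g w * f x \<partial>lborel \<partial>lborel)"
    using integral_lborel_Pair(1)[OF int_lim] by simp
  also have "\<dots> = ?c * (\<integral>x. (f x)\<^sup>2 \<partial>lborel)"
  proof -
    have "(\<integral>w. f x * ?g w * f x \<partial>lborel) = ?c * (f x)\<^sup>2" for x
      using integral_gaussian[where 'a='a] by (simp add: power2_eq_square)
    then show ?thesis by simp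
  qed
  finally have lim: "(\<lambda>k. integral\<^sup>L lborel (F k)) \<longlonglongrightarrow> ?c * (?c * (\<integral>x. (f x)\<^sup>2 \<partial>lborel))"
    unfolding FG by (rule tendsto_mult_left)
  have cc: "?c * ?c = (2 * pi) ^ DIM('a)"
    unfolding power_mult_distrib[symmetric] by simp
  have "has_bochner_integral lborel (\<lambda>\<xi>. (norm (fourier f \<xi>))\<^sup>2) (?c * (?c * (\<integral>x. (f x)\<^sup>2 \<partial>lborel)))"
  proof (rule has_bochner_integral_monotone_convergence)
    show "integrable lborel (F k)" for k
    proof (rule Bochner_Integration.integrable_bound)
      show "integrable lborel (\<lambda>\<xi>. (\<integral>x. \<bar>f x\<bar> \<partial>lborel)\<^sup>2 * exp (- (norm (s k *\<^sub>R \<xi>))\<^sup>2 / 2))"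
        by (intro integrable_mult_right integrable_gaussian_scaled s)
      show "AE \<xi> in lborel. norm (F k \<xi>) \<le> norm ((\<integral>x. \<bar>f x\<bar> \<partial>lborel)\<^sup>2 * exp (- (norm (s k *\<^sub>R \<xi>))\<^sup>2 / 2))"
        by (intro AE_I2) (simp add: F_def abs_mult mult.commute mult_left_mono power_mono fourier_bounded)
    qed (simp add: F_def[abs_def])
    show "AE \<xi> in lborel. mono (\<lambda>k. F k \<xi>)"
    proof (intro AE_I2 monoI)
      fix \<xi> :: 'a and j k :: nat assume "j \<le> k"
      then have "s k \<le> s j" by (simp add: s_def field_simps)
      then have "(norm (s k *\<^sub>R \<xi>))\<^sup>2 \<le> (norm (s j *\<^sub>R \<xi>))\<^sup>2"
        using s[of k] s[of j] by (intro power_mono) (simp_all add: mult_right_mono)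
      then show "F j \<xi> \<le> F k \<xi>"
        unfolding F_def by (intro mult_right_mono) auto
    qed
    show "AE \<xi> in lborel. (\<lambda>k. F k \<xi>) \<longlonglongrightarrow> (norm (fourier f \<xi>))\<^sup>2"
    proof (rule AE_I2)
      fix \<xi> :: 'a
      have "(\<lambda>k. F k \<xi>) \<longlonglongrightarrow> exp (- (norm (0 *\<^sub>R \<xi>))\<^sup>2 / 2) * (norm (fourier f \<xi>))\<^sup>2"
        unfolding F_def by (intro tendsto_intros s0) auto
      then show "(\<lambda>k. F k \<xi>) \<longlonglongrightarrow> (norm (fourier f \<xi>))\<^sup>2" by simp
    qed
  qed (use lim in simp_all)
  then show ?thesis
    using cc by (simp add: mult.assoc[symmetric])
qed

section \<open>Partial derivatives, integration by parts and the Fourier transform\<close>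

lemma axis_inner: "x \<bullet> axis i (1::real) = x $ i"
  by (simp add: inner_axis)

lemma partial_has_derivative:
  assumes "(f has_derivative D) (at x)"
  shows "partial i f x = D (axis i 1)"
  unfolding partial_def using frechet_derivative_at[OF assms] by simp

lemma partial_vector_derivative:
  fixes f :: "real ^ 'n \<Rightarrow> real"
  assumes "f differentiable (at (x + t *\<^sub>R axis i 1))"
  shows "((\<lambda>t. f (x + t *\<^sub>R axis i 1)) has_real_derivative partial i f (x + t *\<^sub>R axis i 1)) (at t)"
proof -
  let ?y = "x + t *\<^sub>R axis i 1"
  have "(f has_derivative frechet_derivative f (at ?y)) (at ?y)"
    using assms frechet_derivative_works by blast
  moreover have "((\<lambda>t. x + t *\<^sub>R axis i 1) has_derivative (\<lambda>h. h *\<^sub>R axis i 1)) (at t)"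
    by (auto intro!: derivative_eq_intros)
  ultimately have "((\<lambda>t. f (x + t *\<^sub>R axis i 1)) has_derivative
      (\<lambda>h. frechet_derivative f (at ?y) (h *\<^sub>R axis i 1))) (at t)"
    by (rule has_derivative_compose[rotated])
  moreover have "frechet_derivative f (at ?y) (h *\<^sub>R axis i 1) = h * partial i f ?y" for h
    using linear_frechet_derivative[OF assms] by (simp add: partial_def linear_cmul)
  ultimately show ?thesis
    by (simp add: has_field_derivative_def mult_commute_abs)
qed

lemma partial_zero_outside_support:
  fixes f :: "real ^ 'n \<Rightarrow> 'b::real_normed_vector"
  assumes "closed K" "\<And>x. x \<notin> K \<Longrightarrow> f x = 0" "x \<notin> K"
  shows "partial i f x = 0"
proof -
  have "(f has_derivative (\<lambda>_. 0)) (at x)"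
  proof (rule has_derivative_transform_within_open)
    show "((\<lambda>_. 0) has_derivative (\<lambda>_. 0)) (at x)" by simp
    show "open (- K)" "x \<in> - K" "\<And>y. y \<in> - K \<Longrightarrow> 0 = f y" using assms by auto
  qed
  then show ?thesis by (simp add: partial_has_derivative)
qed

definition C1_supp :: "(real ^ 'n \<Rightarrow> real) \<Rightarrow> bool"
  where "C1_supp f \<longleftrightarrow> C_supp f \<and> (\<forall>x. f differentiable (at x)) \<and> (\<forall>i. continuous_on UNIV (partial i f))"

lemma C1_supp_partial:
  assumes "C1_supp f" shows "C_supp (partial i f)"
proof -
  obtain K where "compact K" "\<And>x. x \<notin> K \<Longrightarrow> f x = 0"
    using assms by (auto simp: C1_supp_def C_supp_def)
  then have "\<And>x. x \<notin> K \<Longrightarrow> partial i f x = 0"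
    using partial_zero_outside_support compact_imp_closed by metis
  with \<open>compact K\<close> assms show ?thesis by (auto simp: C1_supp_def C_supp_def)
qed

text \<open>By translation invariance every difference quotient of \<open>f\<close> in direction \<open>i\<close> has integral zero.
  The quotients are bounded by the maximum of the partial derivative and vanish outside a common ball, so
  dominated convergence applies.\<close>

lemma integral_partial_eq_0:
  fixes f :: "real ^ 'n \<Rightarrow> real"
  assumes f: "C1_supp f"
  shows "(\<integral>x. partial i f x \<partial>lborel) = 0"
proof -
  let ?e = "axis i 1 :: real ^ 'n"
  have Cf: "C_supp f" and Cp: "C_supp (partial i f)"
    using f C1_supp_partial by (auto simp: C1_supp_def)
  have diff: "f differentiable (at x)" for x using f by (auto simp: C1_supp_def)
  have [measurable]: "f \<in> borel_measurable borel" "partial i f \<in> borel_measurable borel"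
    using Cf Cp by (auto intro: C_supp_borel)
  obtain K where K: "compact K" "\<And>x. x \<notin> K \<Longrightarrow> f x = 0"
    using Cf by (auto simp: C_supp_def)
  obtain B where B: "\<And>x. \<bar>partial i f x\<bar> \<le> B" "B > 0"
    using C_supp_bounded[OF Cp] by metis
  obtain r where r: "r > 0" "\<And>x. x \<in> K \<Longrightarrow> norm x \<le> r"
    using compact_imp_bounded[OF K(1)] bounded_pos by metis
  define s where "s k = inverse (real (Suc k))" for k
  have s: "s k > 0" "s k \<le> 1" for k by (auto simp: s_def field_simps)
  have s0: "s \<longlonglongrightarrow> 0"
    unfolding s_def by (rule LIMSEQ_inverse_real_of_nat)
  define Q where "Q k x = (f (x + s k *\<^sub>R ?e) - f x) / s k" for k x
  have Q_int: "integral\<^sup>L lborel (Q k) = 0" for k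
  proof -
    have "integrable lborel (\<lambda>x. f (s k *\<^sub>R ?e + 1 *\<^sub>R x))"
      by (rule lborel_integrable_affine[OF C_supp_integrable[OF Cf]]) simp
    moreover have "(\<integral>x. f (s k *\<^sub>R ?e + 1 *\<^sub>R x) \<partial>lborel) = integral\<^sup>L lborel f"
      using lborel_integral_affine[of f 1 "s k *\<^sub>R ?e"] by simp
    ultimately show ?thesis
      using C_supp_integrable[OF Cf] unfolding Q_def by (simp add: add.commute)
  qed
  have "(\<lambda>k. integral\<^sup>L lborel (Q k)) \<longlonglongrightarrow> (\<integral>x. partial i f x \<partial>lborel)"
  proof (rule integral_dominated_convergence)
    show "integrable lborel (\<lambda>x. indicator (cball 0 (r + 1)) x *\<^sub>R B)"
      by (intro borel_integrable_compact) auto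
    show "AE x in lborel. (\<lambda>k. Q k x) \<longlonglongrightarrow> partial i f x"
    proof (rule AE_I2)
      fix x
      have "((\<lambda>h. (f (x + h *\<^sub>R ?e) - f x) / h) \<longlongrightarrow> partial i f x) (at 0)"
        using partial_vector_derivative[where x=x and t=0 and i=i, OF diff] by (simp add: has_field_derivative_iff)
      moreover have "filterlim s (at 0) sequentially"
        using s0 s by (simp add: filterlim_at s_def)
      ultimately show "(\<lambda>k. Q k x) \<longlonglongrightarrow> partial i f x"
        unfolding Q_def by (rule filterlim_compose)
    qed
    show "AE x in lborel. norm (Q k x) \<le> indicator (cball 0 (r + 1)) x *\<^sub>R B" for k
    proof (rule AE_I2)
      fix x
      show "norm (Q k x) \<le> indicator (cball 0 (r + 1)) x *\<^sub>R B"
      proof (cases "x \<in> cball 0 (r + 1)")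
        case True
        have "\<exists>z. 0 < z \<and> z < s k \<and> f (x + s k *\<^sub>R ?e) - f (x + 0 *\<^sub>R ?e) = (s k - 0) * partial i f (x + z *\<^sub>R ?e)"
          by (rule MVT2[OF s(1)]) (rule partial_vector_derivative[OF diff])
        then obtain z where z: "f (x + s k *\<^sub>R ?e) - f (x + 0 *\<^sub>R ?e) = (s k - 0) * partial i f (x + z *\<^sub>R ?e)"
          by blast
        have "Q k x = partial i f (x + z *\<^sub>R ?e)"
          unfolding Q_def using z s(1)[of k] by simp
        then show ?thesis using B(1) True by simp
      next
        case False
        then have 1: "norm x > r + 1" by simp
        have "norm x \<le> norm (x + s k *\<^sub>R ?e) + norm (s k *\<^sub>R ?e)"
          by (metis add_diff_cancel_right' norm_triangle_ineq4)
        then have "norm (x + s k *\<^sub>R ?e) > r"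
          using 1 s[of k] by simp
        then have "x \<notin> K" "x + s k *\<^sub>R ?e \<notin> K"
          using r(2)[of x] r(2)[of "x + s k *\<^sub>R ?e"] 1 by linarith+
        then show ?thesis using K(2) False by (simp add: Q_def)
      qed
    qed
  qed (simp_all add: Q_def[abs_def])
  then show ?thesis
    using Q_int by (simp add: LIMSEQ_const_iff)
qed

lemma partial_mult:
  fixes f g :: "real ^ 'n \<Rightarrow> real"
  assumes "f differentiable (at x)" "g differentiable (at x)"
  shows "partial i (\<lambda>y. f y * g y) x = partial i f x * g x + f x * partial i g x"
proof -
  have "((\<lambda>y. f y * g y) has_derivative
     (\<lambda>h. f x * frechet_derivative g (at x) h + frechet_derivative f (at x) h * g x)) (at x)"
    using assms by (intro has_derivative_mult) (simp_all flip: frechet_derivative_works)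
  from partial_has_derivative[OF this] show ?thesis
    by (simp add: partial_def)
qed

lemma C1_supp_mult:
  assumes f: "C1_supp f" and g: "\<And>x. g differentiable (at x)" "\<And>i. continuous_on UNIV (partial i g)"
  shows "C1_supp (\<lambda>x. f x * g x)"
proof -
  have f': "f differentiable (at x)" for x using f by (auto simp: C1_supp_def)
  have cg: "continuous_on UNIV g"
    using g by (simp add: continuous_at_imp_continuous_on differentiable_imp_continuous_within)
  have cf: "continuous_on UNIV f" "continuous_on UNIV (partial i f)" for i
    using f by (auto simp: C1_supp_def C_supp_def)
  have "partial i (\<lambda>x. f x * g x) = (\<lambda>x. partial i f x * g x + f x * partial i g x)" for i
    using partial_mult[OF f' g(1)] by auto
  then show ?thesis
    using f cf cg g f' unfolding C1_supp_def
    by (auto intro!: C_supp_mult_left continuous_intros derivative_intros)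
qed

lemma integral_by_parts:
  fixes f g :: "real ^ 'n \<Rightarrow> real"
  assumes f: "C1_supp f" and g: "\<And>x. g differentiable (at x)" "\<And>i. continuous_on UNIV (partial i g)"
  shows "(\<integral>x. partial i f x * g x \<partial>lborel) = - (\<integral>x. f x * partial i g x \<partial>lborel)"
proof -
  have f': "f differentiable (at x)" for x using f by (auto simp: C1_supp_def)
  have cg: "continuous_on UNIV g"
    using g by (simp add: continuous_at_imp_continuous_on differentiable_imp_continuous_within)
  have "integrable lborel (\<lambda>x. partial i f x * g x)" "integrable lborel (\<lambda>x. f x * partial i g x)"
    using f g cg C1_supp_partial[OF f] by (auto intro!: C_supp_integrable C_supp_mult_left simp: C1_supp_def)
  moreover have "(\<integral>x. partial i f x * g x + f x * partial i g x \<partial>lborel) = 0"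
    using integral_partial_eq_0[OF C1_supp_mult[OF assms], of i] partial_mult[OF f' g(1)] by simp
  ultimately show ?thesis by simp
qed

lemma fourier_components:
  fixes f :: "real ^ 'n \<Rightarrow> real"
  assumes "integrable lborel f"
  shows "Re (fourier f \<xi>) = (\<integral>x. f x * cos (x \<bullet> \<xi>) \<partial>lborel)"
    and "Im (fourier f \<xi>) = - (\<integral>x. f x * sin (x \<bullet> \<xi>) \<partial>lborel)"
proof -
  have [measurable]: "f \<in> borel_measurable borel" using assms by auto
  have int: "integrable lborel (\<lambda>x. f x *\<^sub>R cis (- (x \<bullet> \<xi>)))"
    by (rule Bochner_Integration.integrable_bound[OF assms]) auto
  show "Re (fourier f \<xi>) = (\<integral>x. f x * cos (x \<bullet> \<xi>) \<partial>lborel)"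
    unfolding fourier_def integral_Re[OF int, symmetric] by simp
  show "Im (fourier f \<xi>) = - (\<integral>x. f x * sin (x \<bullet> \<xi>) \<partial>lborel)"
    unfolding fourier_def integral_Im[OF int, symmetric] by simp
qed

lemma partial_cos_sin:
  fixes \<xi> :: "real ^ 'n"
  shows "(\<lambda>x. cos (x \<bullet> \<xi>)) differentiable (at x)" "(\<lambda>x. sin (x \<bullet> \<xi>)) differentiable (at x)"
    and "partial i (\<lambda>x. cos (x \<bullet> \<xi>)) = (\<lambda>x. - (\<xi> $ i) * sin (x \<bullet> \<xi>))"
    and "partial i (\<lambda>x. sin (x \<bullet> \<xi>)) = (\<lambda>x. \<xi> $ i * cos (x \<bullet> \<xi>))"
proof -
  have c: "((\<lambda>x. cos (x \<bullet> \<xi>)) has_derivative (\<lambda>h. - sin (x \<bullet> \<xi>) * (h \<bullet> \<xi>))) (at x)" for x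
    by (auto intro!: derivative_eq_intros)
  have s: "((\<lambda>x. sin (x \<bullet> \<xi>)) has_derivative (\<lambda>h. cos (x \<bullet> \<xi>) * (h \<bullet> \<xi>))) (at x)" for x
    by (auto intro!: derivative_eq_intros)
  show "(\<lambda>x. cos (x \<bullet> \<xi>)) differentiable (at x)" "(\<lambda>x. sin (x \<bullet> \<xi>)) differentiable (at x)"
    using c s by (auto simp: differentiable_def)
  show "partial i (\<lambda>x. cos (x \<bullet> \<xi>)) = (\<lambda>x. - (\<xi> $ i) * sin (x \<bullet> \<xi>))"
    using partial_has_derivative[OF c] by (auto simp: inner_axis' mult.commute)
  show "partial i (\<lambda>x. sin (x \<bullet> \<xi>)) = (\<lambda>x. \<xi> $ i * cos (x \<bullet> \<xi>))"
    using partial_has_derivative[OF s] by (auto simp: inner_axis' mult.commute)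
qed

lemma fourier_partial:
  fixes f :: "real ^ 'n \<Rightarrow> real"
  assumes f: "C1_supp f"
  shows "fourier (partial i f) \<xi> = \<i> * complex_of_real (\<xi> $ i) * fourier f \<xi>"
proof -
  have int: "integrable lborel f" "integrable lborel (partial i f)"
    using f C1_supp_partial by (auto intro!: C_supp_integrable simp: C1_supp_def)
  have e: "f x * (\<xi> $ i * y) = \<xi> $ i * (f x * y)" for x y by simp
  have c: "(\<integral>x. partial i f x * cos (x \<bullet> \<xi>) \<partial>lborel) = \<xi> $ i * (\<integral>x. f x * sin (x \<bullet> \<xi>) \<partial>lborel)"
    by (subst integral_by_parts[OF f partial_cos_sin(1)])
       (auto simp: partial_cos_sin e intro!: continuous_intros)
  have s: "(\<integral>x. partial i f x * sin (x \<bullet> \<xi>) \<partial>lborel) = - \<xi> $ i * (\<integral>x. f x * cos (x \<bullet> \<xi>) \<partial>lborel)"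
    by (subst integral_by_parts[OF f partial_cos_sin(2)])
       (auto simp: partial_cos_sin e intro!: continuous_intros)
  show ?thesis
    by (rule complex_eqI) (simp_all add: fourier_components[OF int(1)] fourier_components[OF int(2)] c s)
qed

lemma fourier_sum:
  assumes "\<And>i. i \<in> I \<Longrightarrow> integrable lborel (f i)"
  shows "fourier (\<lambda>x. \<Sum>i\<in>I. f i x) \<xi> = (\<Sum>i\<in>I. fourier (f i) \<xi>)"
proof -
  have "integrable lborel (\<lambda>x. f i x *\<^sub>R cis (- (x \<bullet> \<xi>)))" if "i \<in> I" for i
  proof (rule Bochner_Integration.integrable_bound[OF assms[OF that]])
    have [measurable]: "f i \<in> borel_measurable borel" using assms[OF that] by auto
    show "(\<lambda>x. f i x *\<^sub>R cis (- (x \<bullet> \<xi>))) \<in> borel_measurable lborel" by simp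
  qed auto
  then show ?thesis
    unfolding fourier_def by (simp add: scaleR_sum_left)
qed

section \<open>Test functions\<close>

lemma partial_component:
  fixes f :: "real ^ 'n \<Rightarrow> real ^ 'm"
  assumes "f differentiable (at x)"
  shows "(\<lambda>y. f y $ j) differentiable (at x)" "partial i (\<lambda>y. f y $ j) x = partial i f x $ j"
proof -
  have "(f has_derivative frechet_derivative f (at x)) (at x)"
    using assms frechet_derivative_works by blast
  from bounded_linear.has_derivative[OF bounded_linear_vec_nth this, of j]
  have *: "((\<lambda>y. f y $ j) has_derivative (\<lambda>h. frechet_derivative f (at x) h $ j)) (at x)" .
  then show "(\<lambda>y. f y $ j) differentiable (at x)" by (auto simp: differentiable_def)
  show "partial i (\<lambda>y. f y $ j) x = partial i f x $ j"
    using partial_has_derivative[OF *] by (simp add: partial_def)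
qed

lemma C_diff_component:
  fixes f :: "real ^ 'n \<Rightarrow> real ^ 'm"
  shows "C_diff k f \<Longrightarrow> C_diff k (\<lambda>x. f x $ j)"
proof (induction k arbitrary: f)
  case 0
  then show ?case by (auto intro!: continuous_intros)
next
  case (Suc k)
  then have d: "f differentiable (at x)" for x by simp
  have "C_diff k (partial i (\<lambda>x. f x $ j))" for i
  proof -
    have "partial i (\<lambda>x. f x $ j) = (\<lambda>x. partial i f x $ j)"
      using partial_component(2)[OF d] by auto
    then show ?thesis using Suc.IH[of "partial i f"] Suc.prems by simp
  qed
  then show ?case using partial_component(1)[OF d] by simp
qed

lemma smooth_partial: "smooth f \<Longrightarrow> smooth (partial i f)"
  unfolding smooth_def by (metis C_diff.simps(2))

lemma smooth_differentiable: "smooth f \<Longrightarrow> f differentiable (at x)"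
  unfolding smooth_def by (metis C_diff.simps(2))

lemma smooth_continuous: "smooth f \<Longrightarrow> continuous_on UNIV f"
  unfolding smooth_def by (metis C_diff.simps(1))

lemma compact_closure_subset:
  assumes "compact (closure T)" "closure S \<subseteq> closure T" shows "compact (closure S)"
  using compact_Int_closed[OF assms(1) closed_closure, of S] assms(2) by (simp add: inf.absorb2)

lemma test_function_component:
  fixes f :: "real ^ 'n \<Rightarrow> real ^ 'n"
  assumes "f \<in> test_functions \<Omega>"
  shows "(\<lambda>x. f x $ j) \<in> test_functions \<Omega>"
proof -
  have "closure {x. f x $ j \<noteq> 0} \<subseteq> closure {x. f x \<noteq> 0}"
    by (intro closure_mono) auto
  moreover from this have "compact (closure {x. f x $ j \<noteq> 0})"
    using assms compact_closure_subset[of "{x. f x \<noteq> 0}" "{x. f x $ j \<noteq> 0}"] by (simp add: test_functions_def)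
  moreover have "smooth (\<lambda>x. f x $ j)"
    using assms by (auto simp: test_functions_def smooth_def intro: C_diff_component)
  ultimately show ?thesis
    using assms by (auto simp: test_functions_def)
qed

lemma test_function_partial:
  fixes f :: "real ^ 'n \<Rightarrow> real"
  assumes "f \<in> test_functions \<Omega>"
  shows "partial i f \<in> test_functions \<Omega>"
proof -
  have "f x = 0" if "x \<notin> closure {x. f x \<noteq> 0}" for x
    using that closure_subset[of "{x. f x \<noteq> 0}"] by auto
  then have "x \<in> closure {x. f x \<noteq> 0}" if "partial i f x \<noteq> 0" for x
    using that partial_zero_outside_support[OF closed_closure] by metis
  then have "closure {x. partial i f x \<noteq> 0} \<subseteq> closure {x. f x \<noteq> 0}"
    by (intro closure_minimal) auto
  moreover from this have "compact (closure {x. partial i f x \<noteq> 0})"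
    using assms compact_closure_subset[of "{x. f x \<noteq> 0}" "{x. partial i f x \<noteq> 0}"] by (simp add: test_functions_def)
  moreover have "smooth (partial i f)"
    using assms by (auto simp: test_functions_def smooth_partial)
  ultimately show ?thesis
    using assms by (auto simp: test_functions_def)
qed

lemma test_function_C1_supp:
  fixes f :: "real ^ 'n \<Rightarrow> real"
  assumes "f \<in> test_functions \<Omega>"
  shows "C1_supp f"
proof -
  have "\<exists>K. compact K \<and> (\<forall>x. x \<notin> K \<longrightarrow> f x = 0)"
    using assms closure_subset[of "{x. f x \<noteq> 0}"]
    by (intro exI[of _ "closure {x. f x \<noteq> 0}"]) (auto simp: test_functions_def)
  then show ?thesis
    using assms unfolding C1_supp_def C_supp_def test_functions_def
    by (auto intro: smooth_continuous smooth_differentiable smooth_partial)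
qed

lemma test_function_outside: "f \<in> test_functions \<Omega> \<Longrightarrow> x \<notin> \<Omega> \<Longrightarrow> f x = 0"
  unfolding test_functions_def using closure_subset[of "{x. f x \<noteq> 0}"] by auto

lemma lebesgue_on_eq_lborel:
  fixes h :: "'a::euclidean_space \<Rightarrow> real"
  assumes "open \<Omega>" and [measurable]: "h \<in> borel_measurable borel" and "\<And>x. x \<notin> \<Omega> \<Longrightarrow> h x = 0"
  shows "integral\<^sup>L (lebesgue_on \<Omega>) h = integral\<^sup>L lborel h"
    and "integrable (lebesgue_on \<Omega>) h \<longleftrightarrow> integrable lborel h"
proof -
  have \<Omega>: "\<Omega> \<inter> space lebesgue \<in> sets (lebesgue :: 'a measure)"
    using assms(1) by simp
  have *: "(\<lambda>x. indicator \<Omega> x *\<^sub>R h x) = h"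
    using assms(3) by (auto simp: indicator_def fun_eq_iff)
  show "integral\<^sup>L (lebesgue_on \<Omega>) h = integral\<^sup>L lborel h"
    unfolding integral_restrict_space[OF \<Omega>] * by (simp add: integral_completion)
  show "integrable (lebesgue_on \<Omega>) h \<longleftrightarrow> integrable lborel h"
    unfolding integrable_restrict_space[OF \<Omega>] * by (simp add: integrable_completion)
qed

lemma borel_measurable_lebesgue_onI:
  "h \<in> borel_measurable borel \<Longrightarrow> h \<in> borel_measurable (lebesgue_on \<Omega>)"
  by (intro measurable_restrict_space1 measurable_completion) simp

section \<open>The space of square integrable functions\<close>

lemma L2_measurable: "f \<in> L2 \<Omega> \<Longrightarrow> f \<in> borel_measurable (lebesgue_on \<Omega>)"
  by (simp add: L2_def)

lemma L2_inner_integrable: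
  assumes f: "f \<in> L2 \<Omega>" and g: "g \<in> L2 \<Omega>"
  shows "integrable (lebesgue_on \<Omega>) (\<lambda>x. f x \<bullet> g x)"
proof (rule Bochner_Integration.integrable_bound)
  have [measurable]: "f \<in> borel_measurable (lebesgue_on \<Omega>)" "g \<in> borel_measurable (lebesgue_on \<Omega>)"
    using f g by (auto simp: L2_measurable)
  show "integrable (lebesgue_on \<Omega>) (\<lambda>x. (norm (f x))\<^sup>2 + (norm (g x))\<^sup>2)"
    using f g by (simp add: L2_def)
  show "(\<lambda>x. f x \<bullet> g x) \<in> borel_measurable (lebesgue_on \<Omega>)" by measurable
  show "AE x in lebesgue_on \<Omega>. norm (f x \<bullet> g x) \<le> norm ((norm (f x))\<^sup>2 + (norm (g x))\<^sup>2)"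
  proof (rule AE_I2)
    fix x
    have "\<bar>f x \<bullet> g x\<bar> \<le> norm (f x) * norm (g x)" by (rule Cauchy_Schwarz_ineq2)
    moreover have "2 * (norm (f x) * norm (g x)) \<le> (norm (f x))\<^sup>2 + (norm (g x))\<^sup>2"
      using sum_squares_bound[of "norm (f x)" "norm (g x)"] by simp
    moreover have "0 \<le> norm (f x) * norm (g x)" by simp
    ultimately show "norm (f x \<bullet> g x) \<le> norm ((norm (f x))\<^sup>2 + (norm (g x))\<^sup>2)"
      unfolding real_norm_def by linarith
  qed
qed

lemma L2_iff: "f \<in> L2 \<Omega> \<longleftrightarrow> f \<in> borel_measurable (lebesgue_on \<Omega>) \<and> integrable (lebesgue_on \<Omega>) (\<lambda>x. f x \<bullet> f x)"
  by (simp add: L2_def power2_norm_eq_inner)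

lemma L2_scaleR: "f \<in> L2 \<Omega> \<Longrightarrow> (\<lambda>x. c *\<^sub>R f x) \<in> L2 \<Omega>"
  by (auto simp: L2_iff intro!: borel_measurable_scaleR)

lemma L2_diff:
  assumes f: "f \<in> L2 \<Omega>" and g: "g \<in> L2 \<Omega>"
  shows "(\<lambda>x. f x - g x) \<in> L2 \<Omega>"
proof -
  have "(\<lambda>x. f x - g x) \<in> borel_measurable (lebesgue_on \<Omega>)"
    using L2_measurable[OF f] L2_measurable[OF g] by (rule borel_measurable_diff)
  moreover have "integrable (lebesgue_on \<Omega>) (\<lambda>x. (f x - g x) \<bullet> (f x - g x))"
    unfolding inner_diff_left inner_diff_right
    by (intro Bochner_Integration.integrable_diff L2_inner_integrable f g)
  ultimately show ?thesis unfolding L2_iff by blast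
qed

lemma L2_sum:
  assumes "\<And>k. k \<in> I \<Longrightarrow> f k \<in> L2 \<Omega>"
  shows "(\<lambda>x. \<Sum>k\<in>I. f k x) \<in> L2 \<Omega>"
proof -
  have "(\<lambda>x. \<Sum>k\<in>I. f k x) \<in> borel_measurable (lebesgue_on \<Omega>)"
    using assms by (intro borel_measurable_sum L2_measurable)
  moreover have "integrable (lebesgue_on \<Omega>) (\<lambda>x. (\<Sum>k\<in>I. f k x) \<bullet> (\<Sum>k\<in>I. f k x))"
    unfolding inner_sum_left inner_sum_right
    using assms by (intro Bochner_Integration.integrable_sum L2_inner_integrable)
  ultimately show ?thesis unfolding L2_iff by blast
qed

lemma L2_inner_nonneg: "L2_inner \<Omega> f f \<ge> 0"
  by (simp add: L2_inner_def)

lemma L2_inner_diff_self: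
  assumes f: "f \<in> L2 \<Omega>" and g: "g \<in> L2 \<Omega>"
  shows "L2_inner \<Omega> (\<lambda>x. f x - g x) (\<lambda>x. f x - g x) = L2_inner \<Omega> f f - 2 * L2_inner \<Omega> f g + L2_inner \<Omega> g g"
proof -
  have "(\<integral>x. g x \<bullet> f x \<partial>lebesgue_on \<Omega>) = (\<integral>x. f x \<bullet> g x \<partial>lebesgue_on \<Omega>)"
    by (simp add: inner_commute)
  then show ?thesis
    unfolding L2_inner_def inner_diff_left inner_diff_right
    using L2_inner_integrable[OF f f] L2_inner_integrable[OF f g] L2_inner_integrable[OF g f] L2_inner_integrable[OF g g]
    by simp
qed

lemma L2_inner_diff_left:
  assumes "f \<in> L2 \<Omega>" "g \<in> L2 \<Omega>" "h \<in> L2 \<Omega>"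
  shows "L2_inner \<Omega> (\<lambda>x. f x - g x) h = L2_inner \<Omega> f h - L2_inner \<Omega> g h"
  using assms by (simp add: L2_inner_def inner_diff_left L2_inner_integrable)

lemma square_diff_le:
  fixes a b :: real
  assumes "\<delta> > 0"
  shows "(a - b)\<^sup>2 \<le> (1 + \<delta>) * a\<^sup>2 + (1 + 1 / \<delta>) * b\<^sup>2"
proof -
  have "0 \<le> (\<delta> * a + b)\<^sup>2 / \<delta>" using assms by simp
  also have "\<dots> = (1 + \<delta>) * a\<^sup>2 + (1 + 1 / \<delta>) * b\<^sup>2 - (a - b)\<^sup>2"
    using assms by (simp add: field_simps power2_eq_square)
  finally show ?thesis by simp
qed

text \<open>Young's inequality: the integrated form of \<open>square_diff_le\<close>. A factor arbitrarily close to \<open>1\<close> in front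
  of the main term is what makes the final limit lossless.\<close>

lemma L2_inner_diff_le:
  assumes f: "f \<in> L2 \<Omega>" and g: "g \<in> L2 \<Omega>" and "\<delta> > 0"
  shows "L2_inner \<Omega> (\<lambda>x. f x - g x) (\<lambda>x. f x - g x) \<le> (1 + \<delta>) * L2_inner \<Omega> f f + (1 + 1 / \<delta>) * L2_inner \<Omega> g g"
proof -
  \<comment> \<open>The difference of the two sides is the square norm of \<open>\<delta> f + g\<close> divided by \<open>\<delta>\<close>.\<close>
  have "0 \<le> L2_inner \<Omega> (\<lambda>x. \<delta> *\<^sub>R f x - (-1) *\<^sub>R g x) (\<lambda>x. \<delta> *\<^sub>R f x - (-1) *\<^sub>R g x) / \<delta>"
    using assms(3) L2_inner_nonneg by (intro divide_nonneg_pos)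
  also have "\<dots> = (\<delta>\<^sup>2 * L2_inner \<Omega> f f + 2 * \<delta> * L2_inner \<Omega> f g + L2_inner \<Omega> g g) / \<delta>"
    by (subst L2_inner_diff_self[OF L2_scaleR[OF f] L2_scaleR[OF g]])
       (simp add: L2_inner_def power2_eq_square)
  also have "\<dots> = (1 + \<delta>) * L2_inner \<Omega> f f + (1 + 1 / \<delta>) * L2_inner \<Omega> g g -
      L2_inner \<Omega> (\<lambda>x. f x - g x) (\<lambda>x. f x - g x)"
    unfolding L2_inner_diff_self[OF f g] using assms(3) by (simp add: field_simps power2_eq_square)
  finally show ?thesis by simp
qed

lemma L2_bessel:
  assumes v: "\<And>k. k \<in> I \<Longrightarrow> v k \<in> L2 \<Omega>" and g: "g \<in> L2 \<Omega>" and "finite I"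
    and orth: "\<And>j k. j \<in> I \<Longrightarrow> k \<in> I \<Longrightarrow> L2_inner \<Omega> (v j) (v k) = (if j = k then 1 else 0)"
  shows "(\<Sum>k\<in>I. (L2_inner \<Omega> (v k) g)\<^sup>2) \<le> L2_inner \<Omega> g g"
proof -
  define c where "c k = L2_inner \<Omega> (v k) g" for k
  define S where "S x = (\<Sum>k\<in>I. c k *\<^sub>R v k x)" for x
  have S: "S \<in> L2 \<Omega>" unfolding S_def[abs_def] by (intro L2_sum L2_scaleR v)
  have vh: "L2_inner \<Omega> S h = (\<Sum>k\<in>I. c k * L2_inner \<Omega> (v k) h)" if "h \<in> L2 \<Omega>" for h
    unfolding L2_inner_def S_def inner_sum_left
    using that v by (simp add: Bochner_Integration.integral_sum L2_inner_integrable)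
  have gS: "L2_inner \<Omega> g S = (\<Sum>k\<in>I. (c k)\<^sup>2)"
    using vh[OF g] by (simp add: L2_inner_def inner_commute c_def power2_eq_square)
  have vS: "L2_inner \<Omega> (v k) S = c k" if "k \<in> I" for k
  proof -
    have "L2_inner \<Omega> (v k) S = L2_inner \<Omega> S (v k)" by (simp add: L2_inner_def inner_commute)
    also have "\<dots> = (\<Sum>j\<in>I. c j * (if j = k then 1 else 0))"
      using vh[OF v[OF that]] orth that by simp
    finally show ?thesis using \<open>finite I\<close> that by (simp add: if_distrib sum.delta cong: if_cong)
  qed
  have SS: "L2_inner \<Omega> S S = (\<Sum>k\<in>I. (c k)\<^sup>2)"
    using vh[OF S] vS by (simp add: power2_eq_square)
  have "0 \<le> L2_inner \<Omega> (\<lambda>x. g x - S x) (\<lambda>x. g x - S x)" by (rule L2_inner_nonneg)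
  also have "\<dots> = L2_inner \<Omega> g g - (\<Sum>k\<in>I. (c k)\<^sup>2)"
    unfolding L2_inner_diff_self[OF g S] gS SS by simp
  finally show ?thesis by (simp add: c_def)
qed

text \<open>The square norm of \<open>f - t g\<close> is a nonnegative quadratic polynomial in \<open>t\<close>.\<close>

lemma L2_cauchy_schwarz:
  assumes f: "f \<in> L2 \<Omega>" and g: "g \<in> L2 \<Omega>"
  shows "(L2_inner \<Omega> f g)\<^sup>2 \<le> L2_inner \<Omega> f f * L2_inner \<Omega> g g"
proof -
  let ?a = "L2_inner \<Omega> f f" and ?b = "L2_inner \<Omega> f g" and ?c = "L2_inner \<Omega> g g"
  have *: "0 \<le> ?a - 2 * t * ?b + t\<^sup>2 * ?c" for t
  proof -
    have "0 \<le> L2_inner \<Omega> (\<lambda>x. f x - t *\<^sub>R g x) (\<lambda>x. f x - t *\<^sub>R g x)" by (rule L2_inner_nonneg)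
    also have "\<dots> = ?a - 2 * t * ?b + t\<^sup>2 * ?c"
      by (subst L2_inner_diff_self[OF f L2_scaleR[OF g]]) (simp add: L2_inner_def power2_eq_square)
    finally show ?thesis .
  qed
  show ?thesis
  proof (cases "?c = 0")
    case True
    have "?b = 0"
    proof (rule ccontr)
      assume "?b \<noteq> 0"
      \<comment> \<open>For this \<open>t\<close> the polynomial, which is affine here, takes the value \<open>-1\<close>.\<close>
      then show False using *[of "(?a + 1) / (2 * ?b)"] True L2_inner_nonneg[of \<Omega> f] by (simp add: field_simps)
    qed
    then show ?thesis using True by simp
  next
    case False
    then have "?c > 0" using L2_inner_nonneg[of \<Omega> g] by linarith
    \<comment> \<open>The minimiser of the polynomial.\<close>
    then show ?thesis using *[of "?b / ?c"] by (simp add: field_simps power2_eq_square)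
  qed
qed

text \<open>Functions close to an orthonormal family satisfy Bessel's inequality up to a small factor:
  the coefficients split into those of the orthonormal family and those of the differences, which the
  Cauchy--Schwarz inequality controls.\<close>

lemma L2_almost_bessel:
  assumes v: "\<And>k. k \<in> I \<Longrightarrow> v k \<in> L2 \<Omega>" and w: "\<And>k. k \<in> I \<Longrightarrow> w k \<in> L2 \<Omega>"
    and g: "g \<in> L2 \<Omega>" and "finite I" "\<delta> > 0"
    and orth: "\<And>j k. j \<in> I \<Longrightarrow> k \<in> I \<Longrightarrow> L2_inner \<Omega> (v j) (v k) = (if j = k then 1 else 0)"
    and close: "\<And>k. k \<in> I \<Longrightarrow> L2_inner \<Omega> (\<lambda>x. v k x - w k x) (\<lambda>x. v k x - w k x) \<le> e"
  shows "(\<Sum>k\<in>I. (L2_inner \<Omega> (w k) g)\<^sup>2) \<le> (1 + \<delta> + (1 + 1 / \<delta>) * (real (card I) * e)) * L2_inner \<Omega> g g"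
proof -
  have "(L2_inner \<Omega> (w k) g)\<^sup>2 \<le> (1 + \<delta>) * (L2_inner \<Omega> (v k) g)\<^sup>2 + (1 + 1 / \<delta>) * (e * L2_inner \<Omega> g g)"
    if k: "k \<in> I" for k
  proof -
    let ?d = "\<lambda>x. v k x - w k x"
    have d: "?d \<in> L2 \<Omega>" by (intro L2_diff v w k)
    have "L2_inner \<Omega> (w k) g = L2_inner \<Omega> (v k) g - L2_inner \<Omega> ?d g"
      using L2_inner_diff_left[OF v[OF k] w[OF k] g] by simp
    then have "(L2_inner \<Omega> (w k) g)\<^sup>2 \<le> (1 + \<delta>) * (L2_inner \<Omega> (v k) g)\<^sup>2 + (1 + 1 / \<delta>) * (L2_inner \<Omega> ?d g)\<^sup>2"
      using square_diff_le[OF \<open>\<delta> > 0\<close>] by simp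
    moreover have "(L2_inner \<Omega> ?d g)\<^sup>2 \<le> e * L2_inner \<Omega> g g"
      by (rule order_trans[OF L2_cauchy_schwarz[OF d g]])
         (intro mult_right_mono close k L2_inner_nonneg)
    then have "(1 + 1 / \<delta>) * (L2_inner \<Omega> ?d g)\<^sup>2 \<le> (1 + 1 / \<delta>) * (e * L2_inner \<Omega> g g)"
      using \<open>\<delta> > 0\<close> by (intro mult_left_mono) auto
    ultimately show ?thesis by linarith
  qed
  then have "(\<Sum>k\<in>I. (L2_inner \<Omega> (w k) g)\<^sup>2) \<le>
      (\<Sum>k\<in>I. (1 + \<delta>) * (L2_inner \<Omega> (v k) g)\<^sup>2 + (1 + 1 / \<delta>) * (e * L2_inner \<Omega> g g))"
    by (rule sum_mono)
  also have "\<dots> = (1 + \<delta>) * (\<Sum>k\<in>I. (L2_inner \<Omega> (v k) g)\<^sup>2) + real (card I) * ((1 + 1 / \<delta>) * (e * L2_inner \<Omega> g g))"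
    by (simp add: sum.distrib sum_distrib_left)
  also have "\<dots> \<le> (1 + \<delta>) * L2_inner \<Omega> g g + real (card I) * ((1 + 1 / \<delta>) * (e * L2_inner \<Omega> g g))"
    using L2_bessel[OF v g \<open>finite I\<close> orth] \<open>\<delta> > 0\<close> by simp
  also have "\<dots> = (1 + \<delta> + (1 + 1 / \<delta>) * (real (card I) * e)) * L2_inner \<Omega> g g"
    by (simp add: algebra_simps)
  finally show ?thesis .
qed

section \<open>Weak gradients and approximation by solenoidal test functions\<close>

lemma L2_vec:
  fixes f :: "real ^ 'n \<Rightarrow> ('b::euclidean_space) ^ 'm"
  assumes "\<And>j. (\<lambda>x. f x $ j) \<in> L2 \<Omega>"
  shows "f \<in> L2 \<Omega>"
proof -
  have "f \<in> borel_measurable (lebesgue_on \<Omega>)"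
    unfolding borel_measurable_euclidean_space[of f]
  proof
    fix b :: "'b ^ 'm" assume "b \<in> Basis"
    then obtain j c where b: "b = axis j c" by (auto simp: Basis_vec_def)
    show "(\<lambda>x. f x \<bullet> b) \<in> borel_measurable (lebesgue_on \<Omega>)"
      unfolding b inner_axis using L2_measurable[OF assms[of j]] by simp
  qed
  moreover have "integrable (lebesgue_on \<Omega>) (\<lambda>x. f x \<bullet> f x)"
    unfolding inner_vec_def by (intro Bochner_Integration.integrable_sum L2_inner_integrable assms)
  ultimately show ?thesis unfolding L2_iff by blast
qed

lemma L2_vec_component:
  fixes f :: "real ^ 'n \<Rightarrow> ('b::euclidean_space) ^ 'm"
  assumes "f \<in> L2 \<Omega>"
  shows "(\<lambda>x. f x $ j) \<in> L2 \<Omega>"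
proof -
  have *: "(\<lambda>x. f x $ j) \<in> borel_measurable (lebesgue_on \<Omega>)"
    using L2_measurable[OF assms] by (rule measurable_compose) (intro borel_measurable_continuous_onI continuous_intros)
  have "integrable (lebesgue_on \<Omega>) (\<lambda>x. f x $ j \<bullet> f x $ j)"
  proof (rule Bochner_Integration.integrable_bound)
    show "integrable (lebesgue_on \<Omega>) (\<lambda>x. f x \<bullet> f x)"
      using assms by (simp add: L2_iff)
    show "AE x in lebesgue_on \<Omega>. norm (f x $ j \<bullet> f x $ j) \<le> norm (f x \<bullet> f x)"
      by (intro AE_I2) (simp add: power2_norm_eq_inner[symmetric] Finite_Cartesian_Product.norm_nth_le power_mono)
  qed (use * in measurable)
  with * show ?thesis unfolding L2_iff by blast
qed

lemma L2_inner_vec: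
  fixes f g :: "real ^ 'n \<Rightarrow> ('b::euclidean_space) ^ 'm"
  assumes "f \<in> L2 \<Omega>" "g \<in> L2 \<Omega>"
  shows "L2_inner \<Omega> f g = (\<Sum>j\<in>UNIV. L2_inner \<Omega> (\<lambda>x. f x $ j) (\<lambda>x. g x $ j))"
  unfolding L2_inner_def inner_vec_def
  by (intro Bochner_Integration.integral_sum L2_inner_integrable L2_vec_component assms)

lemma test_L2_inner:
  fixes \<psi> g :: "real ^ 'n \<Rightarrow> real"
  assumes "open \<Omega>" "\<psi> \<in> test_functions \<Omega>" and [measurable]: "g \<in> borel_measurable borel"
  shows "L2_inner \<Omega> \<psi> g = (\<integral>x. \<psi> x * g x \<partial>lborel)"
proof -
  have [measurable]: "\<psi> \<in> borel_measurable borel"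
    using test_function_C1_supp[OF assms(2)] by (auto simp: C1_supp_def intro: C_supp_borel)
  show ?thesis
    unfolding L2_inner_def inner_real_def
    by (rule lebesgue_on_eq_lborel[OF assms(1)]) (use test_function_outside[OF assms(2)] in auto)
qed

lemma test_L2:
  fixes \<psi> :: "real ^ 'n \<Rightarrow> real"
  assumes "open \<Omega>" "\<psi> \<in> test_functions \<Omega>"
  shows "\<psi> \<in> L2 \<Omega>"
proof -
  have C: "C_supp \<psi>"
    using test_function_C1_supp[OF assms(2)] by (auto simp: C1_supp_def)
  then have [measurable]: "\<psi> \<in> borel_measurable borel" by (rule C_supp_borel)
  have "integrable lborel (\<lambda>x. \<psi> x * \<psi> x)"
    using C by (intro C_supp_integrable C_supp_mult_left) (auto simp: C_supp_def)
  then have "integrable (lebesgue_on \<Omega>) (\<lambda>x. \<psi> x * \<psi> x)"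
    by (subst lebesgue_on_eq_lborel[OF assms(1)]) (use test_function_outside[OF assms(2)] in auto)
  then show ?thesis
    unfolding L2_iff inner_real_def by (simp add: borel_measurable_lebesgue_onI)
qed

lemma test_vec_L2:
  fixes \<phi> :: "real ^ 'n \<Rightarrow> real ^ 'n"
  assumes "open \<Omega>" "\<phi> \<in> test_functions \<Omega>"
  shows "\<phi> \<in> L2 \<Omega>"
  by (intro L2_vec test_L2 test_function_component assms)

definition jacobian :: "(real ^ 'n \<Rightarrow> real ^ 'n) \<Rightarrow> real ^ 'n \<Rightarrow> real ^ 'n ^ 'n"
  where "jacobian \<phi> x = (\<chi> i j. partial i (\<lambda>y. \<phi> y $ j) x)"

lemma jacobian_component [simp]: "jacobian \<phi> x $ i $ j = partial i (\<lambda>y. \<phi> y $ j) x"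
  by (simp add: jacobian_def)

lemma jacobian_test: "\<phi> \<in> test_functions \<Omega> \<Longrightarrow> (\<lambda>x. jacobian \<phi> x $ i $ j) \<in> test_functions \<Omega>"
  using test_function_partial[OF test_function_component, of \<phi> \<Omega> i j] by simp

lemma jacobian_L2:
  fixes \<phi> :: "real ^ 'n \<Rightarrow> real ^ 'n"
  assumes "open \<Omega>" "\<phi> \<in> test_functions \<Omega>"
  shows "jacobian \<phi> \<in> L2 \<Omega>"
  by (intro L2_vec test_L2 jacobian_test assms)

lemma has_weak_gradient_L2_inner:
  fixes u :: "real ^ 'n \<Rightarrow> real ^ 'n"
  shows "has_weak_gradient \<Omega> u G \<longleftrightarrow>
    (\<forall>i j. \<forall>\<psi>\<in>test_functions \<Omega>. L2_inner \<Omega> (\<lambda>x. u x $ j) (partial i \<psi>) = - L2_inner \<Omega> (\<lambda>x. G x $ i $ j) \<psi>)"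
  by (simp add: has_weak_gradient_def L2_inner_def)

lemma has_weak_gradient_jacobian:
  fixes \<phi> :: "real ^ 'n \<Rightarrow> real ^ 'n"
  assumes \<Omega>: "open \<Omega>" and \<phi>: "\<phi> \<in> test_functions \<Omega>"
  shows "has_weak_gradient \<Omega> \<phi> (jacobian \<phi>)"
  unfolding has_weak_gradient_L2_inner
proof (intro allI ballI)
  fix i j and \<psi> :: "real ^ 'n \<Rightarrow> real" assume \<psi>: "\<psi> \<in> test_functions \<Omega>"
  let ?f = "\<lambda>x. \<phi> x $ j"
  have f: "?f \<in> test_functions \<Omega>" by (rule test_function_component[OF \<phi>])
  have Cf: "C1_supp ?f" and C\<psi>: "C1_supp \<psi>"
    using f \<psi> by (auto intro: test_function_C1_supp)
  have [measurable]: "\<psi> \<in> borel_measurable borel" "partial i \<psi> \<in> borel_measurable borel"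
    using C\<psi> C1_supp_partial[OF C\<psi>] by (auto simp: C1_supp_def intro: C_supp_borel)
  have "L2_inner \<Omega> ?f (partial i \<psi>) = (\<integral>x. ?f x * partial i \<psi> x \<partial>lborel)"
    by (rule test_L2_inner[OF \<Omega> f]) simp
  also have "\<dots> = - (\<integral>x. partial i ?f x * \<psi> x \<partial>lborel)"
    using integral_by_parts[OF Cf, of \<psi> i] C\<psi> by (simp add: C1_supp_def)
  also have "(\<integral>x. partial i ?f x * \<psi> x \<partial>lborel) = L2_inner \<Omega> (partial i ?f) \<psi>"
    by (rule test_L2_inner[OF \<Omega> test_function_partial[OF f], symmetric]) simp
  finally show "L2_inner \<Omega> ?f (partial i \<psi>) = - L2_inner \<Omega> (\<lambda>x. jacobian \<phi> x $ i $ j) \<psi>"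
    by simp
qed

lemma has_weak_gradient_diff:
  fixes u v :: "real ^ 'n \<Rightarrow> real ^ 'n"
  assumes "open \<Omega>" "has_weak_gradient \<Omega> u G" "has_weak_gradient \<Omega> v K"
    and "u \<in> L2 \<Omega>" "v \<in> L2 \<Omega>" "G \<in> L2 \<Omega>" "K \<in> L2 \<Omega>"
  shows "has_weak_gradient \<Omega> (\<lambda>x. u x - v x) (\<lambda>x. G x - K x)"
  unfolding has_weak_gradient_L2_inner
proof (intro allI ballI)
  fix i j and \<psi> :: "real ^ 'n \<Rightarrow> real" assume \<psi>: "\<psi> \<in> test_functions \<Omega>"
  have L: "\<psi> \<in> L2 \<Omega>" "partial i \<psi> \<in> L2 \<Omega>"
    using assms(1) \<psi> by (auto intro: test_L2 test_function_partial)
  show "L2_inner \<Omega> (\<lambda>x. (u x - v x) $ j) (partial i \<psi>) = - L2_inner \<Omega> (\<lambda>x. (G x - K x) $ i $ j) \<psi>"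
    unfolding vector_minus_component
    using assms \<psi> L by (simp add: L2_inner_diff_left L2_vec_component has_weak_gradient_L2_inner)
qed

lemma weak_grad:
  assumes "u \<in> H1 \<Omega>"
  shows "weak_grad \<Omega> u \<in> L2 \<Omega>" "has_weak_gradient \<Omega> u (weak_grad \<Omega> u)"
  using assms someI_ex[of "\<lambda>G. G \<in> L2 \<Omega> \<and> has_weak_gradient \<Omega> u G"]
  by (auto simp: H1_def weak_grad_def)

text \<open>The field \<open>G - K\<close> is a weak gradient of \<open>\<phi>\<close>. The entries of the Jacobian of \<open>\<phi>\<close> are test
  functions themselves, so they may be inserted into the definition of the weak gradient. This
  shows that \<open>G - K\<close> minus the Jacobian is orthogonal to the Jacobian; hence the Jacobian is
  the shorter of the two fields.\<close>

lemma jacobian_le_weak_grad: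
  fixes v \<phi> :: "real ^ 'n \<Rightarrow> real ^ 'n"
  assumes \<Omega>: "open \<Omega>" and \<phi>: "\<phi> \<in> test_functions \<Omega>"
    and v: "has_weak_gradient \<Omega> v G" "v \<in> L2 \<Omega>" "G \<in> L2 \<Omega>"
    and d: "has_weak_gradient \<Omega> (\<lambda>x. v x - \<phi> x) K" "K \<in> L2 \<Omega>"
  shows "L2_inner \<Omega> (jacobian \<phi>) (jacobian \<phi>) \<le> L2_inner \<Omega> (\<lambda>x. G x - K x) (\<lambda>x. G x - K x)"
proof -
  note J = jacobian_L2[OF \<Omega> \<phi>] and L = test_vec_L2[OF \<Omega> \<phi>]
  have GK: "(\<lambda>x. G x - K x) \<in> L2 \<Omega>" by (intro L2_diff v d)
  have "has_weak_gradient \<Omega> (\<lambda>x. v x - (v x - \<phi> x)) (\<lambda>x. G x - K x)"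
    by (rule has_weak_gradient_diff[OF \<Omega> v(1) d(1) v(2) L2_diff[OF v(2) L] v(3) d(2)])
  then have w: "has_weak_gradient \<Omega> \<phi> (\<lambda>x. G x - K x)" by simp
  have eq: "L2_inner \<Omega> (\<lambda>x. (G x - K x) $ i $ j) \<psi> = L2_inner \<Omega> (\<lambda>x. jacobian \<phi> x $ i $ j) \<psi>"
    if "\<psi> \<in> test_functions \<Omega>" for i j \<psi>
    using w has_weak_gradient_jacobian[OF \<Omega> \<phi>] that unfolding has_weak_gradient_L2_inner by fastforce
  have vv: "L2_inner \<Omega> f g = (\<Sum>i\<in>UNIV. \<Sum>j\<in>UNIV. L2_inner \<Omega> (\<lambda>x. f x $ i $ j) (\<lambda>x. g x $ i $ j))"
    if "f \<in> L2 \<Omega>" "g \<in> L2 \<Omega>" for f g :: "real ^ 'n \<Rightarrow> real ^ 'n ^ 'n"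
    using that by (simp add: L2_inner_vec L2_vec_component)
  have "L2_inner \<Omega> (\<lambda>x. G x - K x) (jacobian \<phi>) = L2_inner \<Omega> (jacobian \<phi>) (jacobian \<phi>)"
    unfolding vv[OF GK J] vv[OF J J] using eq[OF jacobian_test[OF \<phi>]] by (intro sum.cong refl)
  moreover have "0 \<le> L2_inner \<Omega> (\<lambda>x. (G x - K x) - jacobian \<phi> x) (\<lambda>x. (G x - K x) - jacobian \<phi> x)"
    by (rule L2_inner_nonneg)
  ultimately show ?thesis
    unfolding L2_inner_diff_self[OF GK J] by linarith
qed

text \<open>Split the weak gradient bounding the Jacobian of \<open>\<phi>\<close> into that of \<open>v\<close> and that of \<open>v - \<phi>\<close>.
  The first has square norm \<open>stokes_op \<Omega> v v\<close>, the second is small because \<open>\<phi>\<close> is close to \<open>v\<close>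
  in \<open>H\<^sup>1\<close>.\<close>

lemma stokes_V_approx:
  fixes v :: "real ^ 'n \<Rightarrow> real ^ 'n"
  assumes \<Omega>: "open \<Omega>" and v: "v \<in> stokes_V \<Omega>" and "e > 0" "\<delta> > 0"
  obtains \<phi> where "\<phi> \<in> solenoidal_test \<Omega>"
    "L2_inner \<Omega> (\<lambda>x. v x - \<phi> x) (\<lambda>x. v x - \<phi> x) \<le> e"
    "L2_inner \<Omega> (jacobian \<phi>) (jacobian \<phi>) \<le> (1 + \<delta>) * stokes_op \<Omega> v v + (1 + 1 / \<delta>) * e"
proof -
  have vH1: "v \<in> H1 \<Omega>" using v by (simp add: stokes_V_def)
  then have vL: "v \<in> L2 \<Omega>" by (simp add: H1_def)
  have "sqrt e > 0" using \<open>e > 0\<close> by simp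
  then obtain \<phi> where \<phi>: "\<phi> \<in> solenoidal_test \<Omega>" and lt: "H1_norm \<Omega> (\<lambda>x. v x - \<phi> x) < sqrt e"
    using v unfolding stokes_V_def by blast
  have \<phi>t: "\<phi> \<in> test_functions \<Omega>" using \<phi> by (simp add: solenoidal_test_def)
  let ?d = "\<lambda>x. v x - \<phi> x"
  have L: "?d \<in> L2 \<Omega>" by (intro L2_diff vL test_vec_L2[OF \<Omega> \<phi>t])
  have "has_weak_gradient \<Omega> ?d (\<lambda>x. weak_grad \<Omega> v x - jacobian \<phi> x)"
    by (intro has_weak_gradient_diff \<Omega> weak_grad vH1 vL has_weak_gradient_jacobian \<phi>t test_vec_L2 jacobian_L2)
  moreover have "(\<lambda>x. weak_grad \<Omega> v x - jacobian \<phi> x) \<in> L2 \<Omega>"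
    by (intro L2_diff weak_grad vH1 jacobian_L2 \<Omega> \<phi>t)
  ultimately have dH1: "?d \<in> H1 \<Omega>" using L by (auto simp: H1_def)
  note G = weak_grad[OF vH1] and K = weak_grad[OF dH1]
  have sum: "L2_inner \<Omega> ?d ?d + L2_inner \<Omega> (weak_grad \<Omega> ?d) (weak_grad \<Omega> ?d) < e"
    using lt by (simp add: H1_norm_def L2_norm_def L2_inner_nonneg)
  have "L2_inner \<Omega> (jacobian \<phi>) (jacobian \<phi>) \<le>
      L2_inner \<Omega> (\<lambda>x. weak_grad \<Omega> v x - weak_grad \<Omega> ?d x) (\<lambda>x. weak_grad \<Omega> v x - weak_grad \<Omega> ?d x)"
    by (rule jacobian_le_weak_grad[OF \<Omega> \<phi>t G(2) vL G(1) K(2) K(1)])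
  also have "\<dots> \<le> (1 + \<delta>) * stokes_op \<Omega> v v + (1 + 1 / \<delta>) * L2_inner \<Omega> (weak_grad \<Omega> ?d) (weak_grad \<Omega> ?d)"
    unfolding stokes_op_def by (rule L2_inner_diff_le[OF G(1) K(1) \<open>\<delta> > 0\<close>])
  also have "\<dots> \<le> (1 + \<delta>) * stokes_op \<Omega> v v + (1 + 1 / \<delta>) * e"
    using sum L2_inner_nonneg[of \<Omega> ?d] \<open>\<delta> > 0\<close> by (intro add_left_mono mult_left_mono) auto
  finally show ?thesis
    using that[OF \<phi>] sum L2_inner_nonneg[of \<Omega> "weak_grad \<Omega> ?d"] by auto
qed

section \<open>The pointwise bound in Fourier space\<close>

text \<open>The Fourier transform takes \<open>div \<phi> = 0\<close> to orthogonality of \<open>\<phi>^(\<xi>)\<close> and \<open>\<xi>\<close>.\<close>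

lemma fourier_divergence_free:
  fixes \<phi> :: "real ^ 'n \<Rightarrow> real ^ 'n"
  assumes "\<phi> \<in> solenoidal_test \<Omega>"
  shows "(\<Sum>j\<in>UNIV. complex_of_real (\<xi> $ j) * fourier (\<lambda>x. \<phi> x $ j) \<xi>) = 0"
proof -
  have C: "C1_supp (\<lambda>x. \<phi> x $ j)" for j
    using assms by (auto simp: solenoidal_test_def intro: test_function_C1_supp test_function_component)
  have "fourier (\<lambda>x. \<Sum>j\<in>UNIV. partial j (\<lambda>y. \<phi> y $ j) x) \<xi> = (\<Sum>j\<in>UNIV. fourier (partial j (\<lambda>y. \<phi> y $ j)) \<xi>)"
    by (rule fourier_sum) (intro C_supp_integrable C1_supp_partial C)
  also have "\<dots> = (\<Sum>j\<in>UNIV. \<i> * (complex_of_real (\<xi> $ j) * fourier (\<lambda>x. \<phi> x $ j) \<xi>))"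
    using C by (simp add: fourier_partial mult.assoc)
  also have "\<dots> = \<i> * (\<Sum>j\<in>UNIV. complex_of_real (\<xi> $ j) * fourier (\<lambda>x. \<phi> x $ j) \<xi>)"
    by (rule sum_distrib_left[symmetric])
  finally have "\<i> * (\<Sum>j\<in>UNIV. complex_of_real (\<xi> $ j) * fourier (\<lambda>x. \<phi> x $ j) \<xi>) =
      fourier (\<lambda>x. divergence \<phi> x) \<xi>"
    by (simp add: divergence_def)
  also have "\<dots> = 0"
    using assms by (simp add: solenoidal_test_def fourier_def)
  finally show ?thesis by simp
qed

text \<open>The orthogonal projections of the standard basis vectors to the hyperplane perpendicular to \<open>\<xi>\<close>. They form a tight
  frame of this hyperplane and replace an orthonormal basis of it, which would have to be chosen
  anew for each \<open>\<xi>\<close>.\<close>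

definition perp_axis :: "real ^ 'n \<Rightarrow> 'n \<Rightarrow> real ^ 'n"
  where "perp_axis \<xi> j = axis j 1 - (\<xi> $ j / (norm \<xi>)\<^sup>2) *\<^sub>R \<xi>"

lemma perp_axis_inner:
  assumes "c \<bullet> \<xi> = 0" shows "c \<bullet> perp_axis \<xi> j = c $ j"
  using assms by (simp add: perp_axis_def inner_diff_right axis_inner)

text \<open>The sum is the trace of the projection to a hyperplane.\<close>

lemma sum_norm_perp_axis:
  fixes \<xi> :: "real ^ 'n"
  assumes "\<xi> \<noteq> 0"
  shows "(\<Sum>j\<in>UNIV. (norm (perp_axis \<xi> j))\<^sup>2) = real CARD('n) - 1"
proof -
  have n: "(norm \<xi>)\<^sup>2 \<noteq> 0" using assms by simp
  have "(norm (perp_axis \<xi> j))\<^sup>2 = 1 - (\<xi> $ j)\<^sup>2 / (norm \<xi>)\<^sup>2" for j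
  proof -
    have "(norm (perp_axis \<xi> j))\<^sup>2 = 1 - 2 * (\<xi> $ j / (norm \<xi>)\<^sup>2) * \<xi> $ j + (\<xi> $ j / (norm \<xi>)\<^sup>2)\<^sup>2 * (norm \<xi>)\<^sup>2"
      unfolding perp_axis_def power2_norm_eq_inner
      by (simp add: inner_diff_left inner_diff_right axis_inner inner_axis' power2_eq_square)
    also have "\<dots> = 1 - (\<xi> $ j)\<^sup>2 / (norm \<xi>)\<^sup>2"
      using n by (simp add: field_simps power2_eq_square)
    finally show ?thesis .
  qed
  then have "(\<Sum>j\<in>UNIV. (norm (perp_axis \<xi> j))\<^sup>2) = real CARD('n) - (\<Sum>j\<in>UNIV. (\<xi> $ j)\<^sup>2) / (norm \<xi>)\<^sup>2"
    by (simp add: sum_subtractf sum_divide_distrib)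
  also have "(\<Sum>j\<in>UNIV. (\<xi> $ j)\<^sup>2) = (norm \<xi>)\<^sup>2"
    unfolding power2_norm_eq_inner inner_vec_def by (simp add: power2_eq_square)
  finally show ?thesis using n by simp
qed

text \<open>The function \<open>\<theta>\<close> stands for the real or the imaginary part of the plane wave with frequency \<open>\<xi>\<close>. The vector
  of integrals of \<open>\<phi>\<^sub>k \<theta>\<close> is perpendicular to \<open>\<xi>\<close>, so its \<open>j\<close>-th entry is the inner product of \<open>\<phi>\<^sub>k\<close>
  with \<open>\<theta>\<close> times the projected \<open>j\<close>-th axis. Bessel's inequality applied to these fields produces the
  squared lengths of the projected axes, whose sum is \<open>n - 1\<close> and not \<open>n\<close>.\<close>

lemma transverse_bessel:
  fixes \<phi> :: "'k \<Rightarrow> real ^ 'n \<Rightarrow> real ^ 'n" and \<theta> :: "real ^ 'n \<Rightarrow> real"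
  assumes \<Omega>: "open \<Omega>" and "emeasure lebesgue \<Omega> < \<infinity>" and \<phi>: "\<And>k. k \<in> I \<Longrightarrow> \<phi> k \<in> test_functions \<Omega>"
    and \<theta>: "continuous_on UNIV \<theta>" "\<And>x. \<bar>\<theta> x\<bar> \<le> 1" and \<xi>: "\<xi> \<noteq> 0"
    and perp: "\<And>k. k \<in> I \<Longrightarrow> (\<Sum>j\<in>UNIV. \<xi> $ j * (\<integral>x. \<phi> k x $ j * \<theta> x \<partial>lborel)) = 0"
    and bessel: "\<And>g. g \<in> L2 \<Omega> \<Longrightarrow> (\<Sum>k\<in>I. (L2_inner \<Omega> (\<phi> k) g)\<^sup>2) \<le> C * L2_inner \<Omega> g g"
  shows "integrable (lebesgue_on \<Omega>) (\<lambda>x. (\<theta> x)\<^sup>2)"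
    and "(\<Sum>k\<in>I. \<Sum>j\<in>UNIV. (\<integral>x. \<phi> k x $ j * \<theta> x \<partial>lborel)\<^sup>2) \<le>
      C * (real CARD('n) - 1) * (\<integral>x. (\<theta> x)\<^sup>2 \<partial>lebesgue_on \<Omega>)"
proof -
  have [measurable]: "\<theta> \<in> borel_measurable borel" by (rule borel_measurable_continuous_onI[OF \<theta>(1)])
  have m\<theta>: "\<theta> \<in> borel_measurable (lebesgue_on \<Omega>)" by (rule borel_measurable_lebesgue_onI) simp
  interpret finite_measure "lebesgue_on \<Omega>"
    using assms(2) \<Omega> by (intro finite_measureI) (simp add: emeasure_restrict_space)
  show int: "integrable (lebesgue_on \<Omega>) (\<lambda>x. (\<theta> x)\<^sup>2)"
  proof (rule integrable_const_bound[where B=1])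
    show "AE x in lebesgue_on \<Omega>. norm ((\<theta> x)\<^sup>2) \<le> 1"
      using \<theta>(2) by (intro AE_I2) (simp add: abs_square_le_1)
  qed (use m\<theta> in simp)
  define c :: "'k \<Rightarrow> real ^ 'n" where "c k = (\<chi> j. \<integral>x. \<phi> k x $ j * \<theta> x \<partial>lborel)" for k
  define g :: "'n \<Rightarrow> real ^ 'n \<Rightarrow> real ^ 'n" where "g j x = \<theta> x *\<^sub>R perp_axis \<xi> j" for j x
  have gL: "g j \<in> L2 \<Omega>" for j
    unfolding L2_def g_def[abs_def] using m\<theta> int
    by (auto simp: power_mult_distrib intro!: borel_measurable_scaleR)
  have gg: "L2_inner \<Omega> (g j) (g j) = (norm (perp_axis \<xi> j))\<^sup>2 * (\<integral>x. (\<theta> x)\<^sup>2 \<partial>lebesgue_on \<Omega>)" for j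
  proof -
    have "g j x \<bullet> g j x = (norm (perp_axis \<xi> j))\<^sup>2 * (\<theta> x)\<^sup>2" for x
      unfolding power2_norm_eq_inner by (simp add: g_def power2_eq_square)
    then show ?thesis by (simp add: L2_inner_def)
  qed
  have cg: "c k $ j = L2_inner \<Omega> (\<phi> k) (g j)" if k: "k \<in> I" for k j
  proof -
    have "c k \<bullet> \<xi> = 0"
      using perp[OF k] by (simp add: c_def inner_vec_def mult.commute)
    then have "c k $ j = c k \<bullet> perp_axis \<xi> j" by (simp add: perp_axis_inner)
    also have "\<dots> = (\<Sum>i\<in>UNIV. perp_axis \<xi> j $ i * (\<integral>x. \<phi> k x $ i * \<theta> x \<partial>lborel))"
      by (simp add: c_def inner_vec_def mult.commute)
    also have "\<dots> = (\<Sum>i\<in>UNIV. L2_inner \<Omega> (\<lambda>x. \<phi> k x $ i) (\<lambda>x. g j x $ i))"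
    proof (rule sum.cong[OF refl])
      fix i
      have "L2_inner \<Omega> (\<lambda>x. \<phi> k x $ i) (\<lambda>x. g j x $ i) = (\<integral>x. \<phi> k x $ i * (\<theta> x * perp_axis \<xi> j $ i) \<partial>lborel)"
        unfolding g_def vector_scaleR_component real_scaleR_def
        by (rule test_L2_inner[OF \<Omega> test_function_component[OF \<phi>[OF k]]]) simp
      also have "\<dots> = perp_axis \<xi> j $ i * (\<integral>x. \<phi> k x $ i * \<theta> x \<partial>lborel)"
        unfolding integral_mult_right_zero[symmetric]
        by (intro Bochner_Integration.integral_cong refl) (simp only: mult_ac)
      finally show "perp_axis \<xi> j $ i * (\<integral>x. \<phi> k x $ i * \<theta> x \<partial>lborel) =
          L2_inner \<Omega> (\<lambda>x. \<phi> k x $ i) (\<lambda>x. g j x $ i)" by simp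
    qed
    also have "\<dots> = L2_inner \<Omega> (\<phi> k) (g j)"
      by (rule L2_inner_vec[symmetric, OF test_vec_L2[OF \<Omega> \<phi>[OF k]] gL])
    finally show ?thesis .
  qed
  have "(\<Sum>k\<in>I. \<Sum>j\<in>UNIV. (\<integral>x. \<phi> k x $ j * \<theta> x \<partial>lborel)\<^sup>2) = (\<Sum>k\<in>I. \<Sum>j\<in>UNIV. (L2_inner \<Omega> (\<phi> k) (g j))\<^sup>2)"
    using cg by (intro sum.cong refl) (simp flip: cg add: c_def)
  also have "\<dots> = (\<Sum>j\<in>UNIV. \<Sum>k\<in>I. (L2_inner \<Omega> (\<phi> k) (g j))\<^sup>2)"
    by (rule sum.swap)
  also have "\<dots> \<le> (\<Sum>j\<in>UNIV. C * L2_inner \<Omega> (g j) (g j))"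
    by (intro sum_mono bessel gL)
  also have "\<dots> = C * (\<Sum>j\<in>UNIV. (norm (perp_axis \<xi> j))\<^sup>2) * (\<integral>x. (\<theta> x)\<^sup>2 \<partial>lebesgue_on \<Omega>)"
    unfolding gg sum_distrib_left sum_distrib_right by (simp add: mult.assoc)
  finally show "(\<Sum>k\<in>I. \<Sum>j\<in>UNIV. (\<integral>x. \<phi> k x $ j * \<theta> x \<partial>lborel)\<^sup>2) \<le>
      C * (real CARD('n) - 1) * (\<integral>x. (\<theta> x)\<^sup>2 \<partial>lebesgue_on \<Omega>)"
    unfolding sum_norm_perp_axis[OF \<xi>] .
qed

text \<open>The real and the imaginary part are estimated separately; the squares of cosine and sine add up
  to \<open>1\<close>, so together they cost exactly \<open>\<bar>\<Omega>\<bar>\<close>.\<close>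

lemma fourier_sum_bound:
  fixes \<phi> :: "'k \<Rightarrow> real ^ 'n \<Rightarrow> real ^ 'n"
  assumes \<Omega>: "open \<Omega>" and fin: "emeasure lebesgue \<Omega> < \<infinity>" and \<phi>: "\<And>k. k \<in> I \<Longrightarrow> \<phi> k \<in> solenoidal_test \<Omega>"
    and bessel: "\<And>g. g \<in> L2 \<Omega> \<Longrightarrow> (\<Sum>k\<in>I. (L2_inner \<Omega> (\<phi> k) g)\<^sup>2) \<le> C * L2_inner \<Omega> g g"
    and \<xi>: "\<xi> \<noteq> 0"
  shows "(\<Sum>k\<in>I. \<Sum>j\<in>UNIV. (norm (fourier (\<lambda>x. \<phi> k x $ j) \<xi>))\<^sup>2) \<le> C * (real CARD('n) - 1) * measure lebesgue \<Omega>"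
proof -
  have \<phi>t: "\<phi> k \<in> test_functions \<Omega>" if "k \<in> I" for k using \<phi>[OF that] by (simp add: solenoidal_test_def)
  have int: "integrable lborel (\<lambda>x. \<phi> k x $ j)" if "k \<in> I" for k j
    using test_function_C1_supp[OF test_function_component[OF \<phi>t[OF that]]]
    by (intro C_supp_integrable) (auto simp: C1_supp_def)
  note F = fourier_components[OF int]
  let ?c = "\<lambda>k j. \<integral>x. \<phi> k x $ j * cos (x \<bullet> \<xi>) \<partial>lborel" and ?s = "\<lambda>k j. \<integral>x. \<phi> k x $ j * sin (x \<bullet> \<xi>) \<partial>lborel"
  have perp: "(\<Sum>j\<in>UNIV. \<xi> $ j * ?c k j) = 0" "(\<Sum>j\<in>UNIV. \<xi> $ j * ?s k j) = 0" if k: "k \<in> I" for k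
    using arg_cong[OF fourier_divergence_free[OF \<phi>[OF k], of \<xi>], of Re]
      arg_cong[OF fourier_divergence_free[OF \<phi>[OF k], of \<xi>], of Im] by (simp_all add: F[OF k] sum_negf)
  have cont: "continuous_on UNIV (\<lambda>x. cos (x \<bullet> \<xi>))" "continuous_on UNIV (\<lambda>x. sin (x \<bullet> \<xi>))"
    by (intro continuous_intros)+
  note C = transverse_bessel[OF \<Omega> fin \<phi>t cont(1) abs_cos_le_one \<xi> perp(1) bessel]
  note S = transverse_bessel[OF \<Omega> fin \<phi>t cont(2) abs_sin_le_one \<xi> perp(2) bessel]
  have "(\<Sum>k\<in>I. \<Sum>j\<in>UNIV. (norm (fourier (\<lambda>x. \<phi> k x $ j) \<xi>))\<^sup>2) =
      (\<Sum>k\<in>I. \<Sum>j\<in>UNIV. (?c k j)\<^sup>2) + (\<Sum>k\<in>I. \<Sum>j\<in>UNIV. (?s k j)\<^sup>2)"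
    unfolding sum.distrib[symmetric] by (intro sum.cong refl) (simp add: cmod_power2 F)
  also have "\<dots> \<le> C * (real CARD('n) - 1) * (\<integral>x. (cos (x \<bullet> \<xi>))\<^sup>2 \<partial>lebesgue_on \<Omega>) +
      C * (real CARD('n) - 1) * (\<integral>x. (sin (x \<bullet> \<xi>))\<^sup>2 \<partial>lebesgue_on \<Omega>)"
    by (rule add_mono[OF C(2) S(2)])
  also have "\<dots> = C * (real CARD('n) - 1) * (\<integral>x. (cos (x \<bullet> \<xi>))\<^sup>2 + (sin (x \<bullet> \<xi>))\<^sup>2 \<partial>lebesgue_on \<Omega>)"
  proof -
    have "integrable (lebesgue_on \<Omega>) (\<lambda>x. (cos (x \<bullet> \<xi>))\<^sup>2)" "integrable (lebesgue_on \<Omega>) (\<lambda>x. (sin (x \<bullet> \<xi>))\<^sup>2)"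
      using C(1) S(1) by blast+
    from Bochner_Integration.integral_add[OF this] show ?thesis
      by (simp only: distrib_left)
  qed
  also have "(\<integral>x. (cos (x \<bullet> \<xi>))\<^sup>2 + (sin (x \<bullet> \<xi>))\<^sup>2 \<partial>lebesgue_on \<Omega>) = measure lebesgue \<Omega>"
    using \<Omega> by (simp add: measure_restrict_space)
  finally show ?thesis .
qed

section \<open>The bathtub principle\<close>

text \<open>Since \<open>R\<^sup>2 - \<bar>\<xi>\<bar>\<^sup>2\<close> is the integral of \<open>2 r\<close> over \<open>\<bar>\<xi>\<bar> \<le> r \<le> R\<close>, exchanging the integrals reduces the
  claim to the volumes of the balls of radius \<open>r\<close>.\<close>

lemma integral_ball_parabola:
  assumes R: "R > 0"
  shows "has_bochner_integral lborel (\<lambda>\<xi>::'a::euclidean_space. indicator (cball 0 R) \<xi> * (R\<^sup>2 - (norm \<xi>)\<^sup>2))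
    (2 / (2 + real DIM('a)) * unit_ball_vol (real DIM('a)) * R ^ (DIM('a) + 2))"
proof -
  let ?n = "DIM('a)" and ?w = "unit_ball_vol (real DIM('a))"
  \<comment> \<open>The integrand on the region \<open>\<bar>\<xi>\<bar> \<le> r \<le> R\<close>; integrating out \<open>r\<close> gives the parabola.\<close>
  define h :: "'a \<times> real \<Rightarrow> real" where "h p = (if norm (fst p) \<le> snd p \<and> snd p \<le> R then 2 * snd p else 0)" for p
  have [measurable]: "h \<in> borel_measurable borel"
    unfolding h_def[abs_def] by measurable
  have hb: "norm (h p) \<le> 2 * R" for p
  proof (cases "norm (fst p) \<le> snd p \<and> snd p \<le> R")
    case True
    then have "0 \<le> snd p" using norm_ge_zero[of "fst p"] by linarith
    then show ?thesis using True by (simp add: h_def)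
  qed (use R in \<open>auto simp: h_def\<close>)
  have ind: "integrable lborel (indicator (cball 0 R) :: 'a \<Rightarrow> real)" "integrable lborel (indicator {0..R} :: real \<Rightarrow> real)"
    using emeasure_bounded_finite[of "cball (0::'a) R"] emeasure_bounded_finite[of "{0..R}"]
    by (auto intro!: integrable_real_indicator)
  have eq: "(indicator (cball 0 R) (fst p) * indicator {0..R} (snd p)) *\<^sub>R h p = h p" for p
    using order_trans[OF norm_ge_zero[of "fst p"]] by (auto simp: h_def indicator_def)
  have int: "integrable lborel h"
    using integrable_lborel_tensor[OF ind, of h "2 * R"] hb unfolding eq by simp
  have 1: "(\<integral>r. h (\<xi>, r) \<partial>lborel) = indicator (cball 0 R) \<xi> * (R\<^sup>2 - (norm \<xi>)\<^sup>2)" for \<xi>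
  proof (cases "norm \<xi> \<le> R")
    case True
    have "(\<integral>r. h (\<xi>, r) \<partial>lborel) = (\<integral>r. 2 * r * indicator {norm \<xi>..R} r \<partial>lborel)"
      by (intro Bochner_Integration.integral_cong) (auto simp: h_def indicator_def)
    also have "\<dots> = R\<^sup>2 - (norm \<xi>)\<^sup>2"
      by (rule integral_FTC_Icc_real[OF True]) (auto intro!: derivative_eq_intros continuous_intros)
    finally show ?thesis using True by simp
  next
    case False
    then have "h (\<xi>, r) = 0" for r by (auto simp: h_def)
    then show ?thesis using False by simp
  qed
  have 2: "(\<integral>\<xi>. h (\<xi>, r) \<partial>lborel) = 2 * ?w * r ^ (?n + 1) * indicator {0..R} r" for r
  proof (cases "r \<in> {0..R}")
    case True
    have "(\<integral>\<xi>. h (\<xi>, r) \<partial>lborel) = (\<integral>\<xi>. 2 * r * indicator (cball (0::'a) r) \<xi> \<partial>lborel)"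
      using True by (intro Bochner_Integration.integral_cong) (auto simp: h_def indicator_def)
    also have "\<dots> = 2 * r * measure lborel (cball (0::'a) r)"
      by simp
    also have "\<dots> = 2 * r * (?w * r ^ ?n)"
      using True by (simp add: content_cball)
    finally show ?thesis using True by simp
  next
    case False
    then have "h (\<xi>, r) = 0" for \<xi> using norm_ge_zero[of \<xi>] by (auto simp: h_def simp del: norm_ge_zero)
    then show ?thesis using False by simp
  qed
  have "integrable (lborel \<Otimes>\<^sub>M lborel) h" using int by (simp add: lborel_prod)
  from lborel_pair.integrable_fst'[OF this]
  have "integrable lborel (\<lambda>\<xi>::'a. indicator (cball 0 R) \<xi> * (R\<^sup>2 - (norm \<xi>)\<^sup>2))"
    unfolding 1 .
  moreover have "(\<integral>\<xi>. indicator (cball 0 R) \<xi> * (R\<^sup>2 - (norm (\<xi>::'a))\<^sup>2) \<partial>lborel) =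
      (\<integral>r. 2 * ?w * r ^ (?n + 1) * indicator {0..R} r \<partial>lborel)"
    using integral_lborel_Pair[OF int] unfolding 1 2 by simp
  moreover have "(\<integral>r. 2 * ?w * r ^ (?n + 1) * indicator {0..R} r \<partial>lborel) =
     2 * ?w / (2 + real ?n) * R ^ (?n + 2) - 2 * ?w / (2 + real ?n) * 0 ^ (?n + 2)"
  proof (rule integral_FTC_Icc_real)
    show "((\<lambda>r. 2 * ?w / (2 + real ?n) * r ^ (?n + 2)) has_real_derivative 2 * ?w * r ^ (?n + 1)) (at r)"
      for r :: real
      using DERIV_cmult[OF DERIV_pow[of "?n + 2" r UNIV], of "2 * ?w / (2 + real ?n)"] by (simp add: mult.assoc)
  qed (use R in \<open>auto intro!: continuous_intros\<close>)
  ultimately show ?thesis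
    by (simp add: has_bochner_integral_iff)
qed

text \<open>The inequality \<open>(R\<^sup>2 - \<bar>\<xi>\<bar>\<^sup>2) F(\<xi>) \<le> M max(R\<^sup>2 - \<bar>\<xi>\<bar>\<^sup>2, 0)\<close> holds pointwise, with equality if \<open>F\<close>
  is \<open>M\<close> times the indicator of the ball of radius \<open>R\<close>.\<close>

lemma bathtub:
  fixes F :: "'a::euclidean_space \<Rightarrow> real"
  assumes F: "integrable lborel F" "integrable lborel (\<lambda>\<xi>. (norm \<xi>)\<^sup>2 * F \<xi>)"
    and bound: "\<And>\<xi>. 0 \<le> F \<xi>" "\<And>\<xi>. \<xi> \<noteq> 0 \<Longrightarrow> F \<xi> \<le> M" and R: "R > 0"
  shows "R\<^sup>2 * (\<integral>\<xi>. F \<xi> \<partial>lborel) - M * (2 / (2 + real DIM('a)) * unit_ball_vol (real DIM('a)) * R ^ (DIM('a) + 2))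
    \<le> (\<integral>\<xi>. (norm \<xi>)\<^sup>2 * F \<xi> \<partial>lborel)"
proof -
  note P = integral_ball_parabola[OF R, where 'a='a, unfolded has_bochner_integral_iff]
  have "(\<integral>\<xi>. R\<^sup>2 * F \<xi> - (norm \<xi>)\<^sup>2 * F \<xi> \<partial>lborel) \<le> (\<integral>\<xi>. M * (indicator (cball 0 R) \<xi> * (R\<^sup>2 - (norm (\<xi>::'a))\<^sup>2)) \<partial>lborel)"
  proof (rule integral_mono_AE)
    show "AE \<xi> in lborel. R\<^sup>2 * F \<xi> - (norm \<xi>)\<^sup>2 * F \<xi> \<le> M * (indicator (cball 0 R) \<xi> * (R\<^sup>2 - (norm \<xi>)\<^sup>2))"
      using AE_lborel_singleton[of "0::'a"]
    proof eventually_elim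
      fix \<xi> :: 'a assume "\<xi> \<noteq> 0"
      show "R\<^sup>2 * F \<xi> - (norm \<xi>)\<^sup>2 * F \<xi> \<le> M * (indicator (cball 0 R) \<xi> * (R\<^sup>2 - (norm \<xi>)\<^sup>2))"
      proof (cases "norm \<xi> \<le> R")
        case True
        then have "(norm \<xi>)\<^sup>2 \<le> R\<^sup>2" by (intro power_mono) auto
        then have "F \<xi> * (R\<^sup>2 - (norm \<xi>)\<^sup>2) \<le> M * (R\<^sup>2 - (norm \<xi>)\<^sup>2)"
          using bound(2)[OF \<open>\<xi> \<noteq> 0\<close>] by (intro mult_right_mono) auto
        then show ?thesis using True by (simp add: algebra_simps)
      next
        case False
        then have "R\<^sup>2 \<le> (norm \<xi>)\<^sup>2" using R by (intro power_mono) auto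
        then have "R\<^sup>2 * F \<xi> \<le> (norm \<xi>)\<^sup>2 * F \<xi>" using bound(1) by (intro mult_right_mono) auto
        then show ?thesis using False by simp
      qed
    qed
  qed (use F P in auto)
  then show ?thesis using F P by simp
qed

section \<open>The bound for the eigenvalue sums\<close>

text \<open>Plancherel's theorem identifies the two integrals in the bathtub inequality with the square norms of the
  \<open>\<phi>\<^sub>k\<close> and of their Jacobians, because differentiation multiplies the transform by \<open>\<i> \<xi>\<^sub>i\<close>.\<close>

lemma solenoidal_energy_bound:
  fixes \<phi> :: "'k \<Rightarrow> real ^ 'n \<Rightarrow> real ^ 'n"
  assumes \<Omega>: "open \<Omega>" and fin: "emeasure lebesgue \<Omega> < \<infinity>" and I: "finite I"
    and \<phi>: "\<And>k. k \<in> I \<Longrightarrow> \<phi> k \<in> solenoidal_test \<Omega>"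
    and bessel: "\<And>g. g \<in> L2 \<Omega> \<Longrightarrow> (\<Sum>k\<in>I. (L2_inner \<Omega> (\<phi> k) g)\<^sup>2) \<le> C * L2_inner \<Omega> g g"
    and R: "R > 0"
  shows "R\<^sup>2 * ((2 * pi) ^ CARD('n) * (\<Sum>k\<in>I. L2_inner \<Omega> (\<phi> k) (\<phi> k)))
      - C * ((real CARD('n) - 1) * measure lebesgue \<Omega>) *
        (2 / (2 + real CARD('n)) * unit_ball_vol (real CARD('n)) * R ^ (CARD('n) + 2))
    \<le> (2 * pi) ^ CARD('n) * (\<Sum>k\<in>I. L2_inner \<Omega> (jacobian (\<phi> k)) (jacobian (\<phi> k)))"
proof -
  let ?p = "(2 * pi) ^ CARD('n)"
  have \<phi>t: "\<phi> k \<in> test_functions \<Omega>" if "k \<in> I" for k using \<phi>[OF that] by (simp add: solenoidal_test_def)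
  have plancherel_test: "has_bochner_integral lborel (\<lambda>\<xi>. (norm (fourier \<psi> \<xi>))\<^sup>2) (?p * L2_inner \<Omega> \<psi> \<psi>)"
    if \<psi>: "\<psi> \<in> test_functions \<Omega>" for \<psi> :: "real ^ 'n \<Rightarrow> real"
  proof -
    have C: "C_supp \<psi>" using test_function_C1_supp[OF \<psi>] by (simp add: C1_supp_def)
    have "L2_inner \<Omega> \<psi> \<psi> = (\<integral>x. (\<psi> x)\<^sup>2 \<partial>lborel)"
      using test_L2_inner[OF \<Omega> \<psi> C_supp_borel[OF C]] by (simp add: power2_eq_square)
    then show ?thesis using plancherel[OF C] by simp
  qed
  define F where "F \<xi> = (\<Sum>k\<in>I. \<Sum>j\<in>UNIV. (norm (fourier (\<lambda>x. \<phi> k x $ j) \<xi>))\<^sup>2)" for \<xi>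
  have F: "has_bochner_integral lborel F (?p * (\<Sum>k\<in>I. L2_inner \<Omega> (\<phi> k) (\<phi> k)))"
  proof -
    have "has_bochner_integral lborel F (\<Sum>k\<in>I. \<Sum>j\<in>UNIV. ?p * L2_inner \<Omega> (\<lambda>x. \<phi> k x $ j) (\<lambda>x. \<phi> k x $ j))"
      unfolding F_def[abs_def]
      by (intro has_bochner_integral_sum plancherel_test test_function_component \<phi>t)
    also have "(\<Sum>k\<in>I. \<Sum>j\<in>UNIV. ?p * L2_inner \<Omega> (\<lambda>x. \<phi> k x $ j) (\<lambda>x. \<phi> k x $ j)) =
        ?p * (\<Sum>k\<in>I. L2_inner \<Omega> (\<phi> k) (\<phi> k))"
      using test_vec_L2[OF \<Omega> \<phi>t] by (simp add: sum_distrib_left L2_inner_vec)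
    finally show ?thesis .
  qed
  have G: "has_bochner_integral lborel (\<lambda>\<xi>. (norm \<xi>)\<^sup>2 * F \<xi>)
      (?p * (\<Sum>k\<in>I. L2_inner \<Omega> (jacobian (\<phi> k)) (jacobian (\<phi> k))))"
  proof -
    have "(norm \<xi>)\<^sup>2 * F \<xi> = (\<Sum>k\<in>I. \<Sum>i\<in>UNIV. \<Sum>j\<in>UNIV. (norm (fourier (\<lambda>x. jacobian (\<phi> k) x $ i $ j) \<xi>))\<^sup>2)" for \<xi> :: "real ^ 'n"
    proof -
      have "(norm \<xi>)\<^sup>2 = (\<Sum>i\<in>UNIV. (\<xi> $ i)\<^sup>2)"
        unfolding power2_norm_eq_inner inner_vec_def by (simp add: power2_eq_square)
      then have "(norm \<xi>)\<^sup>2 * F \<xi> =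
          (\<Sum>k\<in>I. \<Sum>i\<in>UNIV. \<Sum>j\<in>UNIV. (\<xi> $ i)\<^sup>2 * (norm (fourier (\<lambda>x. \<phi> k x $ j) \<xi>))\<^sup>2)"
        by (simp only: F_def sum_product sum_distrib_left[of _ _ I])
      also have "\<dots> = (\<Sum>k\<in>I. \<Sum>i\<in>UNIV. \<Sum>j\<in>UNIV. (norm (fourier (\<lambda>x. jacobian (\<phi> k) x $ i $ j) \<xi>))\<^sup>2)"
      proof (intro sum.cong refl)
        fix k i j assume "k \<in> I"
        then have "C1_supp (\<lambda>x. \<phi> k x $ j)"
          using test_function_C1_supp[OF test_function_component[OF \<phi>t]] by blast
        then show "(\<xi> $ i)\<^sup>2 * (norm (fourier (\<lambda>x. \<phi> k x $ j) \<xi>))\<^sup>2 =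
            (norm (fourier (\<lambda>x. jacobian (\<phi> k) x $ i $ j) \<xi>))\<^sup>2"
          by (simp add: fourier_partial norm_mult power_mult_distrib)
      qed
      finally show ?thesis .
    qed
    then have "has_bochner_integral lborel (\<lambda>\<xi>. (norm \<xi>)\<^sup>2 * F \<xi>)
       (\<Sum>k\<in>I. \<Sum>i\<in>UNIV. \<Sum>j\<in>UNIV. ?p * L2_inner \<Omega> (\<lambda>x. jacobian (\<phi> k) x $ i $ j) (\<lambda>x. jacobian (\<phi> k) x $ i $ j))"
      by (simp only:) (intro has_bochner_integral_sum plancherel_test jacobian_test \<phi>t)
    also have "(\<Sum>k\<in>I. \<Sum>i\<in>UNIV. \<Sum>j\<in>UNIV. ?p * L2_inner \<Omega> (\<lambda>x. jacobian (\<phi> k) x $ i $ j) (\<lambda>x. jacobian (\<phi> k) x $ i $ j)) =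
        ?p * (\<Sum>k\<in>I. L2_inner \<Omega> (jacobian (\<phi> k)) (jacobian (\<phi> k)))"
      using jacobian_L2[OF \<Omega> \<phi>t] by (simp add: sum_distrib_left L2_inner_vec L2_vec_component del: jacobian_component)
    finally show ?thesis .
  qed
  have "F \<xi> \<le> C * ((real CARD('n) - 1) * measure lebesgue \<Omega>)" if "\<xi> \<noteq> 0" for \<xi>
    using fourier_sum_bound[OF \<Omega> fin \<phi> bessel that] by (simp add: F_def mult.assoc)
  moreover have "0 \<le> F \<xi>" for \<xi> unfolding F_def by (intro sum_nonneg) simp
  ultimately show ?thesis
    using bathtub[of F "C * ((real CARD('n) - 1) * measure lebesgue \<Omega>)" R] F G R
    by (simp add: has_bochner_integral_iff)
qed

text \<open>Apply the previous lemma to test functions approximating the eigenfunctions, with an error governed by \<open>\<delta>\<close>,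
  and let \<open>\<delta> \<rightarrow> 0\<close> for fixed \<open>R\<close>.\<close>

lemma stokes_berezin_li_yau:
  fixes \<Omega> :: "(real ^ 'n) set"
  assumes \<Omega>: "open \<Omega>" and fin: "emeasure lebesgue \<Omega> < \<infinity>" and I: "finite I"
    and v: "\<And>k. k \<in> I \<Longrightarrow> stokes_eigenfunction \<Omega> (\<mu> k) (v k)"
    and orth: "\<And>j k. j \<in> I \<Longrightarrow> k \<in> I \<Longrightarrow> L2_inner \<Omega> (v j) (v k) = (if j = k then 1 else 0)"
    and R: "R > 0"
  shows "R\<^sup>2 * ((2 * pi) ^ CARD('n) * card I)
      - (real CARD('n) - 1) * measure lebesgue \<Omega> *
        (2 / (2 + real CARD('n)) * unit_ball_vol (real CARD('n)) * R ^ (CARD('n) + 2))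
    \<le> (2 * pi) ^ CARD('n) * (\<Sum>k\<in>I. \<mu> k)"
proof -
  let ?p = "(2 * pi) ^ CARD('n)"
  let ?D = "(real CARD('n) - 1) * measure lebesgue \<Omega>"
  let ?W = "2 / (2 + real CARD('n)) * unit_ball_vol (real CARD('n)) * R ^ (CARD('n) + 2)"
  define m where "m = real (card I)"
  have vV: "v k \<in> stokes_V \<Omega>" if "k \<in> I" for k using v[OF that] by (simp add: stokes_eigenfunction_def)
  then have vL: "v k \<in> L2 \<Omega>" if "k \<in> I" for k using that by (auto simp: stokes_V_def H1_def)
  have vv: "stokes_op \<Omega> (v k) (v k) = \<mu> k" if "k \<in> I" for k
    using v[OF that] vV[OF that] orth[OF that that] by (simp add: stokes_eigenfunction_def)
  have main: "R\<^sup>2 * (?p * (m * (1 - \<delta>) / (1 + \<delta>))) - (1 + \<delta> + m * \<delta>) * ?D * ?W \<le>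
      ?p * ((1 + \<delta>) * (\<Sum>k\<in>I. \<mu> k) + m * \<delta>)" if \<delta>: "\<delta> > 0" for \<delta>
  proof -
    \<comment> \<open>This choice makes the weight \<open>1 + 1 / \<delta>\<close> from Young's inequality times \<open>e\<close> equal to \<open>\<delta>\<close>.\<close>
    define e where "e = \<delta> / (1 + 1 / \<delta>)"
    have pos: "1 + 1 / \<delta> > 0" using \<delta> by (simp add: add_pos_pos)
    have e: "e > 0" "(1 + 1 / \<delta>) * e = \<delta>" using \<delta> pos by (auto simp: e_def)
    have "\<forall>k\<in>I. \<exists>\<phi>. \<phi> \<in> solenoidal_test \<Omega> \<and> L2_inner \<Omega> (\<lambda>x. v k x - \<phi> x) (\<lambda>x. v k x - \<phi> x) \<le> e \<and>
      L2_inner \<Omega> (jacobian \<phi>) (jacobian \<phi>) \<le> (1 + \<delta>) * \<mu> k + \<delta>"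
    proof
      fix k assume k: "k \<in> I"
      show "\<exists>\<phi>. \<phi> \<in> solenoidal_test \<Omega> \<and> L2_inner \<Omega> (\<lambda>x. v k x - \<phi> x) (\<lambda>x. v k x - \<phi> x) \<le> e \<and>
        L2_inner \<Omega> (jacobian \<phi>) (jacobian \<phi>) \<le> (1 + \<delta>) * \<mu> k + \<delta>"
        using stokes_V_approx[OF \<Omega> vV[OF k] e(1) \<delta>] unfolding vv[OF k] e(2) by blast
    qed
    from bchoice[OF this] obtain \<phi> where \<phi>: "\<And>k. k \<in> I \<Longrightarrow> \<phi> k \<in> solenoidal_test \<Omega>"
      and close: "\<And>k. k \<in> I \<Longrightarrow> L2_inner \<Omega> (\<lambda>x. v k x - \<phi> k x) (\<lambda>x. v k x - \<phi> k x) \<le> e"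
      and grad: "\<And>k. k \<in> I \<Longrightarrow> L2_inner \<Omega> (jacobian (\<phi> k)) (jacobian (\<phi> k)) \<le> (1 + \<delta>) * \<mu> k + \<delta>"
      by blast
    have \<phi>L: "\<phi> k \<in> L2 \<Omega>" if "k \<in> I" for k
      using \<phi>[OF that] by (intro test_vec_L2[OF \<Omega>]) (simp add: solenoidal_test_def)
    have C: "1 + \<delta> + (1 + 1 / \<delta>) * (real (card I) * e) = 1 + \<delta> + m * \<delta>"
      using e(2) by (simp add: m_def mult.left_commute)
    have bessel: "(\<Sum>k\<in>I. (L2_inner \<Omega> (\<phi> k) g)\<^sup>2) \<le> (1 + \<delta> + m * \<delta>) * L2_inner \<Omega> g g" if "g \<in> L2 \<Omega>" for g
      using L2_almost_bessel[OF vL \<phi>L that I \<delta> orth close] unfolding C by blast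
    have low: "(1 - \<delta>) / (1 + \<delta>) \<le> L2_inner \<Omega> (\<phi> k) (\<phi> k)" if k: "k \<in> I" for k
    proof -
      have "(\<lambda>x. \<phi> k x - (\<phi> k x - v k x)) = v k" by auto
      then have "L2_inner \<Omega> (v k) (v k) \<le> (1 + \<delta>) * L2_inner \<Omega> (\<phi> k) (\<phi> k) +
         (1 + 1 / \<delta>) * L2_inner \<Omega> (\<lambda>x. \<phi> k x - v k x) (\<lambda>x. \<phi> k x - v k x)"
        using L2_inner_diff_le[OF \<phi>L[OF k] L2_diff[OF \<phi>L[OF k] vL[OF k]] \<delta>] by simp
      also have "L2_inner \<Omega> (\<lambda>x. \<phi> k x - v k x) (\<lambda>x. \<phi> k x - v k x) = L2_inner \<Omega> (\<lambda>x. v k x - \<phi> k x) (\<lambda>x. v k x - \<phi> k x)"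
        by (simp add: L2_inner_def inner_diff_left inner_diff_right algebra_simps)
      also have "(1 + 1 / \<delta>) * \<dots> \<le> \<delta>"
        using mult_left_mono[OF close[OF k], of "1 + 1 / \<delta>"] pos e(2) by simp
      finally show ?thesis
        using orth[OF k k] \<delta> by (simp add: divide_le_eq algebra_simps)
    qed
    have "m * ((1 - \<delta>) / (1 + \<delta>)) \<le> (\<Sum>k\<in>I. L2_inner \<Omega> (\<phi> k) (\<phi> k))"
      using sum_mono[of I "\<lambda>_. (1 - \<delta>) / (1 + \<delta>)", OF low] by (simp add: m_def)
    then have "R\<^sup>2 * (?p * (m * (1 - \<delta>) / (1 + \<delta>))) - (1 + \<delta> + m * \<delta>) * ?D * ?W \<le>
        R\<^sup>2 * (?p * (\<Sum>k\<in>I. L2_inner \<Omega> (\<phi> k) (\<phi> k))) - (1 + \<delta> + m * \<delta>) * ?D * ?W"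
      by (intro diff_right_mono mult_left_mono) auto
    also have "\<dots> \<le> ?p * (\<Sum>k\<in>I. L2_inner \<Omega> (jacobian (\<phi> k)) (jacobian (\<phi> k)))"
      by (rule solenoidal_energy_bound[OF \<Omega> fin I \<phi> bessel R])
    also have "\<dots> \<le> ?p * (\<Sum>k\<in>I. (1 + \<delta>) * \<mu> k + \<delta>)"
      by (intro mult_left_mono sum_mono grad) auto
    also have "(\<Sum>k\<in>I. (1 + \<delta>) * \<mu> k + \<delta>) = (1 + \<delta>) * (\<Sum>k\<in>I. \<mu> k) + m * \<delta>"
      by (simp add: sum.distrib sum_distrib_left m_def)
    finally show ?thesis .
  qed
  have "R\<^sup>2 * (?p * (m * (1 - 0) / (1 + 0))) - (1 + 0 + m * 0) * ?D * ?W \<le>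
      ?p * ((1 + 0) * (\<Sum>k\<in>I. \<mu> k) + m * 0)"
  proof (rule tendsto_le)
    show "((\<lambda>\<delta>. R\<^sup>2 * (?p * (m * (1 - \<delta>) / (1 + \<delta>))) - (1 + \<delta> + m * \<delta>) * ?D * ?W) \<longlongrightarrow>
        R\<^sup>2 * (?p * (m * (1 - 0) / (1 + 0))) - (1 + 0 + m * 0) * ?D * ?W) (at_right 0)"
      by (intro tendsto_intros) auto
    show "((\<lambda>\<delta>. ?p * ((1 + \<delta>) * (\<Sum>k\<in>I. \<mu> k) + m * \<delta>)) \<longlongrightarrow> ?p * ((1 + 0) * (\<Sum>k\<in>I. \<mu> k) + m * 0)) (at_right 0)"
      by (intro tendsto_intros)
    show "\<forall>\<^sub>F \<delta> in at_right 0. R\<^sup>2 * (?p * (m * (1 - \<delta>) / (1 + \<delta>))) - (1 + \<delta> + m * \<delta>) * ?D * ?W \<le>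
        ?p * ((1 + \<delta>) * (\<Sum>k\<in>I. \<mu> k) + m * \<delta>)"
      using eventually_at_right_less[of "0::real"] by eventually_elim (rule main)
  qed simp
  then show ?thesis by (simp add: m_def)
qed

text \<open>The left-hand side of the hypothesis is largest for \<open>R\<^sup>N = p m / (w D)\<close>, the radius at which the ball filled to
  height \<open>D\<close> has mass \<open>p m\<close>.\<close>

lemma optimal_radius:
  fixes m p D w S :: real and N :: nat
  assumes N: "N \<ge> 1" and pos: "m > 0" "p > 0" "D > 0" "w > 0"
    and bound: "\<And>R. R > 0 \<Longrightarrow> R\<^sup>2 * (p * m) - D * (2 / (2 + real N) * w * R ^ (N + 2)) \<le> p * S"
  shows "real N / (2 + real N) * (p / (w * D)) powr (2 / real N) * m powr (1 + 2 / real N) \<le> S"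
proof -
  define T where "T = p * m / (w * D)"
  define R where "R = T powr (1 / real N)"
  have T: "T > 0" using pos by (simp add: T_def)
  have R: "R > 0" using T by (simp add: R_def)
  have RN: "R ^ N = T"
    using T N by (simp add: R_def powr_realpow[symmetric] powr_powr)
  have R2: "R\<^sup>2 = (p / (w * D)) powr (2 / real N) * m powr (2 / real N)"
    using pos unfolding R_def T_def
    by (simp add: powr_realpow[symmetric] powr_powr powr_mult powr_divide)
  have "p * (real N / (2 + real N) * R\<^sup>2 * m) = R\<^sup>2 * (p * m) - D * (2 / (2 + real N) * w * (T * R\<^sup>2))"
  proof -
    have "D * w * T = p * m" using pos by (simp add: T_def)
    moreover have "D * (2 / (2 + real N) * w * (T * R\<^sup>2)) = 2 / (2 + real N) * ((D * w * T) * R\<^sup>2)"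
      by (simp only: mult_ac)
    ultimately have *: "D * (2 / (2 + real N) * w * (T * R\<^sup>2)) = 2 / (2 + real N) * (p * m * R\<^sup>2)"
      by (simp only:)
    have **: "real N / (2 + real N) = 1 - 2 / (2 + real N)" by (simp add: field_simps)
    show ?thesis unfolding * ** by (simp add: algebra_simps)
  qed
  also have "T * R\<^sup>2 = R ^ (N + 2)"
    by (simp add: power_add RN power2_eq_square)
  also have "R\<^sup>2 * (p * m) - D * (2 / (2 + real N) * w * R ^ (N + 2)) \<le> p * S" by (rule bound[OF R])
  finally have "real N / (2 + real N) * R\<^sup>2 * m \<le> S" using pos(2) by (rule mult_left_le_imp_le)
  then show ?thesis
    unfolding R2 using pos by (simp add: powr_add mult_ac)
qed

theorem theorem2p2:
  fixes \<Omega> :: "(real ^ 'n) set" and lam :: "nat \<Rightarrow> real" and m :: nat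
  assumes "CARD('n) \<ge> 2"
    and "open \<Omega>"
    and "emeasure lebesgue \<Omega> < \<infinity>"
    and "stokes_eigenvalues \<Omega> lam"
    and "m \<ge> 1"
  shows "(\<Sum>k=1..m. lam k) \<ge>
    real CARD('n) / (2 + real CARD('n)) *
    ((2 * pi) ^ CARD('n) /
      (unit_ball_vol (real CARD('n)) * (real CARD('n) - 1) * measure lebesgue \<Omega>))
      powr (2 / real CARD('n)) *
    real m powr (1 + 2 / real CARD('n))"
proof -
  obtain v where v: "stokes_eigensystem \<Omega> lam v"
    using assms(4) by (auto simp: stokes_eigenvalues_def)
  have bound: "R\<^sup>2 * ((2 * pi) ^ CARD('n) * real m)
      - (real CARD('n) - 1) * measure lebesgue \<Omega> *
        (2 / (2 + real CARD('n)) * unit_ball_vol (real CARD('n)) * R ^ (CARD('n) + 2))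
    \<le> (2 * pi) ^ CARD('n) * (\<Sum>k=1..m. lam k)" if "R > 0" for R
    using stokes_berezin_li_yau[OF assms(2,3), of "{1..m}" lam v R] v that
    by (simp add: stokes_eigensystem_def)
  \<comment> \<open>For a null set \<open>\<Omega>\<close> the right-hand side is \<open>0\<close>, as division by \<open>0\<close> yields \<open>0\<close>.\<close>
  show ?thesis
  proof (cases "measure lebesgue \<Omega> = 0")
    case True
    have "0 < lam k" if "k \<in> {1..m}" for k
      using v that by (simp add: stokes_eigensystem_def)
    then have "0 \<le> (\<Sum>k=1..m. lam k)" by (intro sum_nonneg) (simp add: less_imp_le)
    then show ?thesis using True by simp
  next
    case False
    then have "(real CARD('n) - 1) * measure lebesgue \<Omega> > 0"
      using assms(1) by (intro mult_pos_pos) (auto simp: zero_less_measure_iff)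
    then show ?thesis
      using optimal_radius[of "CARD('n)" "real m" "(2 * pi) ^ CARD('n)" "(real CARD('n) - 1) * measure lebesgue \<Omega>"
          "unit_ball_vol (real CARD('n))" "\<Sum>k=1..m. lam k", OF _ _ _ _ _ bound] assms(5)
      by (simp add: mult.assoc)
  qed
qed

end
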